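(* Let $d,m\in\mathbb{N}$, $A\in\mathbb{R}^{d\times d}$ and $B\in\mathbb{R}^{d\times m}$. Assume that all eigenvalues of $A$ lie in the closed unit disk, and that every eigenvalue $\lambda$ of $A$ with $|\lambda|=1$ has equal algebraic and geometric multiplicities. Assume the pair $(A,B)$ is stabilizable. Let $(w_t)_{t\in\mathbb{N}_0}$ be a sequence of mutually independent $\mathbb{R}^d$-valued random vectors (not necessarily identically distributed) with $\mathsf{E}[w_t]=0$, $\mathsf{E}[w_tw_t^{\mathrm T}]=Q_t$, and $\sup_{t\in\mathbb{N}_0}\mathsf{E}[\|w_t\|^4]<\infty$. Consider the system $$x_{t+1}=Ax_t+Bu_t+w_t,\qquad x_0=x,\quad t\in\mathbb{N}_0 .$$ Then there exist $R>0$, an integer $k\le d$, and a deterministic $k$-history-dependent policy $(\pi_t)_{t\in\mathbb{N}_0}$, i.e. measurable maps $\pi_t:\mathbb{R}^{d\times k}\to\mathbb{R}^m$ with $\|\pi_t(\cdot)\|\le R$ for every $t$, such that, for the closed-loop system $$x_{t+1}=Ax_t+B\pi_t(x_t,x_{t-1},\ldots,x_{t-k+1})+w_t,\qquad x_0=x,\quad t\in\mathbb{N}_0,$$ (with the convention $x_{-k+1}=\cdots=x_{-1}=x_0$): (P1) for every fixed $x\in\mathbb{R}^d$ the process $(x_t)_{t\in\mathbb{N}_0}$ satisfies $\sup_{t\in\mathbb{N}_0}\mathsf{E}_x[\|x_t\|^2]<\infty$; and (P2) in the absence of noise (i.e. with $w_t\equiv 0$) the origin is asymptotically stable for the closed-loop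 system.
   Context: $\|\cdot\|$ denotes the Euclidean norm. $\mathsf{E}_x$ denotes expectation given the initial condition $x_0=x$ (deterministic). Stabilizable means there is a matrix $K$ with $A+BK$ having all eigenvalues in the open unit disk. *)

theory Defs
  imports "HOL-Probability.Probability" "HOL-Computational_Algebra.Polynomial"
begin

definition cmat :: "real^'n^'n \<Rightarrow> complex^'n^'n" where
  "cmat A = (\<chi> i j. complex_of_real (A $ i $ j))"

definition charpoly :: "real^'n^'n \<Rightarrow> complex poly" where
  "charpoly A = det (\<chi> i j. (if i = j then [:0, 1:] else 0) - [: cmat A $ i $ j :])"

definition is_eigenvalue :: "real^'n^'n \<Rightarrow> complex \<Rightarrow> bool" where
  "is_eigenvalue A l \<longleftrightarrow> (\<exists>v. v \<noteq> 0 \<and> cmat A *v v = l *s v)"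

definition alg_mult :: "real^'n^'n \<Rightarrow> complex \<Rightarrow> nat" where
  "alg_mult A l = order l (charpoly A)"

definition geom_mult :: "real^'n^'n \<Rightarrow> complex \<Rightarrow> nat" where
  "geom_mult A l = vec.dim {v :: complex^'n. cmat A *v v = l *s v}"

definition stabilizable :: "real^'n^'n \<Rightarrow> real^'m^'n \<Rightarrow> bool" where
  "stabilizable A B \<longleftrightarrow>
     (\<exists>K :: real^'n^'m. \<forall>l. is_eigenvalue (A + B ** K) l \<longrightarrow> cmod l < 1)"

text \<open>History of the closed-loop system under a k-history-dependent policy pol and
  noise realisation w: cl_hist A B k pol w x t i = x_(t-i) for i \<le> t and = x_0 for i > t
  (convention x_(-j) = x_0).  The policy at time t is applied to the restriction of the
  history to indices {..<k}, i.e. to (x_t, x_(t-1), ..., x_(t-k+1)).\<close>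
primrec cl_hist ::
  "real^'d^'d \<Rightarrow> real^'m^'d \<Rightarrow> nat \<Rightarrow> (nat \<Rightarrow> (nat \<Rightarrow> real^'d) \<Rightarrow> real^'m)
    \<Rightarrow> (nat \<Rightarrow> real^'d) \<Rightarrow> real^'d \<Rightarrow> nat \<Rightarrow> nat \<Rightarrow> real^'d" where
  "cl_hist A B k pol w x 0 = (\<lambda>i. x)"
| "cl_hist A B k pol w x (Suc t) =
     (\<lambda>i. if i = 0
          then A *v cl_hist A B k pol w x t 0
               + B *v pol t (restrict (cl_hist A B k pol w x t) {..<k}) + w t
          else cl_hist A B k pol w x t (i - 1))"

definition cl_state ::
  "real^'d^'d \<Rightarrow> real^'m^'d \<Rightarrow> nat \<Rightarrow> (nat \<Rightarrow> (nat \<Rightarrow> real^'d) \<Rightarrow> real^'m)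
    \<Rightarrow> (nat \<Rightarrow> real^'d) \<Rightarrow> real^'d \<Rightarrow> nat \<Rightarrow> real^'d" where
  "cl_state A B k pol w x t = cl_hist A B k pol w x t 0"

definition asymp_stable_origin :: "('a::real_normed_vector \<Rightarrow> nat \<Rightarrow> 'a) \<Rightarrow> bool" where
  "asymp_stable_origin traj \<longleftrightarrow>
     (\<forall>e>0. \<exists>\<delta>>0. \<forall>x. norm x < \<delta> \<longrightarrow> (\<forall>t. norm (traj x t) < e)) \<and>
     (\<exists>\<eta>>0. \<forall>x. norm x < \<eta> \<longrightarrow> (traj x \<longlonglongrightarrow> 0))"

end

theory Submission
  imports Defs "HOL-Computational_Algebra.Fundamental_Theorem_Algebra"
begin

text \<open>
  The spectral hypotheses make \<open>A\<close> power bounded, so the limit of \<open>sup_m |A^(n+m) x|\<close> for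
  \<open>n \<rightarrow> \<infinity>\<close> is a seminorm \<open>o\<close> for which \<open>A\<close> is isometric and whose null space consists of the
  points attracted to the origin by \<open>A\<close>. Stabilizability and the recurrence of the isometry imply
  that modulo this null space every point is reachable in \<open>d\<close> steps. Hence at each multiple of
  \<open>d\<close> one can choose, as bounded functions of the current state \<open>y\<close>, the next \<open>d\<close> controls in such
  a way that without noise \<open>o(y)\<close> drops to \<open>max (o(y) - r) 0\<close>; the controller remembers \<open>y\<close>
  through the history. With noise \<open>o\<close> is dominated by a Lindley recursion
  \<open>V' = max 0 (V + \<xi> - r)\<close>, which has bounded second moments if \<open>r\<close> is large compared with the
  fourth moments of \<open>\<xi>\<close>. The full state is controlled by \<open>o\<close> and a norm \<open>q\<close> with
  \<open>q(A x) \<le> \<theta> q(x) + C o(x)\<close>, \<open>\<theta> < 1\<close>.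
\<close>

section \<open>Semisimple eigenvalues\<close>

text \<open>A single control acts only through the range of \<open>B\<close>, so a direction of the
  quotient by the null space may need up to \<open>d\<close> steps to become accessible. This is why
  controls are planned for whole blocks and why the memory is \<open>k = d\<close>. No Jordan form
  is used: annihilating polynomials of vectors and the limit seminorm replace the splitting of
  \<open>A\<close> into a stable and an orthogonal part. The noise enters the recursion for the
  seminorm through nonnegative sums \<xi> over a block, so \<open>r\<close> must exceed their mean
  by a surplus \<open>c\<close>. Fourth moments are needed because a jump of size about
  \<open>c j\<close>, seen from \<open>j\<close> blocks later, contributes to the second moment of
  the excess; \<xi>^2 <= \<xi>^4 / (c j)^2 on that event makes the contributions summable in
  \<open>j\<close>. The remaining error contains the second moment of the excess itself; a large
  \<open>c\<close> makes its coefficient small enough to close an induction. None of these constants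
  depends on the initial state, so one \<open>R\<close> serves all of them. Stability without noise
  requires the controls to vanish on the null space, hence a bound on them by the seminorm besides
  the bound by \<open>r\<close>.\<close>

lemma prod_dvd_det_of_columns:
  fixes M :: "'a::comm_ring_1^'n^'n"
  assumes "\<And>i j. q j dvd M $ i $ j"
  shows "(\<Prod>j\<in>UNIV. q j) dvd det M"
proof -
  \<comment> \<open>Each Leibniz term takes exactly one factor from every column.\<close>
  have "(\<Prod>j\<in>UNIV. q j) dvd of_int (sign p) * (\<Prod>i\<in>UNIV. M $ i $ p i)"
    if "p permutes UNIV" for p
  proof -
    have "(\<Prod>j\<in>UNIV. q j) = (\<Prod>i\<in>UNIV. q (p i))"
      using prod.permute[OF that, of q] by (simp add: o_def)
    also have "\<dots> dvd (\<Prod>i\<in>UNIV. M $ i $ p i)"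
      using assms by (intro prod_dvd_prod) auto
    finally show ?thesis by (rule dvd_mult)
  qed
  then show ?thesis
    unfolding det_def by (intro dvd_sum) auto
qed

lemma poly_det:
  fixes M :: "'a::comm_ring_1 poly^'n^'n"
  shows "poly (det M) x = det (\<chi> i j. poly (M $ i $ j) x)"
  by (simp add: det_def poly_sum poly_prod)

definition char_matrix :: "real^'n^'n \<Rightarrow> complex poly^'n^'n" where
  "char_matrix A = (\<chi> i j. (if i = j then [:0, 1:] else 0) - [: cmat A $ i $ j :])"

lemma poly_charpoly:
  "poly (charpoly A) x = det (mat x - cmat A)"
  unfolding charpoly_def poly_det
  by (rule arg_cong[where f = det]) (auto simp: vec_eq_iff mat_def)

lemma mat_mult_vec [simp]: "mat (c::complex) *v v = c *s v"
  by (simp add: vec_eq_iff mat_def matrix_vector_mult_def if_distrib[of "\<lambda>a. a * _"] cong: if_cong)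

text \<open>The order of a root says something only for a nonzero polynomial; a point that is no
  eigenvalue is a point where the determinant does not vanish.\<close>

lemma charpoly_nonzero:
  assumes "\<not> is_eigenvalue A x"
  shows "charpoly A \<noteq> 0"
proof -
  have "\<exists>B. B ** (mat x - cmat A) = mat 1"
    unfolding matrix_left_invertible_ker
    using assms by (auto simp: is_eigenvalue_def matrix_vector_mult_diff_rdistrib)
  then have "det (mat x - cmat A) \<noteq> 0"
    unfolding invertible_left_inverse[symmetric] invertible_det_nz .
  then show ?thesis
    using poly_charpoly[of A x] by auto
qed

lemma det_columns_basis_nonzero:
  fixes f :: "'n::finite \<Rightarrow> 'a::field^'n"
  assumes "vec.span (range f) = UNIV"
  shows "det (\<chi> i j. f j $ i) \<noteq> 0"
proof -
  have "columns (\<chi> i j. f j $ i) = range f"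
    by (auto simp: columns_def column_def vec_lambda_eta)
  then show ?thesis
    using assms
    by (simp flip: invertible_det_nz add: invertible_right_inverse matrix_right_invertible_span_columns)
qed

text \<open>If \<open>u = (A - l) v\<close> is a nonzero eigenvector, complete it to a basis \<open>f\<close> of the whole space
  through a basis of the eigenspace and replace the column \<open>u\<close> by \<open>(x - l) v + u\<close>. Multiplying the
  result by \<open>x I - A\<close> produces one more factor \<open>x - l\<close> than the eigenspace has dimensions, while
  the determinant of the multiplier does not vanish at \<open>x = l\<close>.\<close>

lemma semisimple_eigenvalue:
  fixes A :: "real^'n^'n"
  assumes mult: "alg_mult A l = geom_mult A l"
    and nz: "charpoly A \<noteq> 0"
    and ker: "cmat A *v (cmat A *v v - l *s v) = l *s (cmat A *v v - l *s v)"
  shows "cmat A *v v = l *s v"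
proof (rule ccontr)
  define u where "u = cmat A *v v - l *s v"
  assume "cmat A *v v \<noteq> l *s v"
  then have "u \<noteq> 0" by (simp add: u_def)
  define S where "S = {v. cmat A *v v = l *s v}"
  have uS: "u \<in> S" using ker by (simp add: S_def u_def)
  obtain B0 where B0: "{u} \<subseteq> B0" "B0 \<subseteq> S" "vec.independent B0" "S \<subseteq> vec.span B0"
    using vec.maximal_independent_subset_extend[of "{u}" S] uS \<open>u \<noteq> 0\<close> by auto
  have cardB0: "card B0 = geom_mult A l"
    using vec.basis_card_eq_dim[OF B0(2,4,3)] by (simp add: geom_mult_def S_def)
  define B1 where "B1 = vec.extend_basis B0"
  have B1: "B0 \<subseteq> B1" "vec.independent B1" "vec.span B1 = UNIV"
    using vec.extend_basis_superset[OF B0(3)] vec.independent_extend_basis[OF B0(3)]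
      vec.span_extend_basis[OF B0(3)] by (auto simp: B1_def)
  have "card B1 = CARD('n)"
    using vec.basis_card_eq_dim[of B1 UNIV] B1 by (simp add: card_cart_basis)
  moreover have "finite B1"
    using B1(2) vec.finiteI_independent by blast
  ultimately obtain f :: "'n \<Rightarrow> complex^'n" where f: "bij_betw f UNIV B1"
    using finite_same_card_bij[of "UNIV :: 'n set" B1] by auto
  define I where "I = f -` B0"
  have "f ` I = B0"
    using f B1(1) by (auto simp: I_def bij_betw_def)
  moreover have "inj f" using f by (simp add: bij_betw_def)
  ultimately have cardI: "card I = geom_mult A l"
    using cardB0 card_image[of f I] by (metis inj_on_subset subset_UNIV)
  obtain i0 where i0: "f i0 = u" "i0 \<in> I"
    using B0(1) \<open>f ` I = B0\<close> by auto
  define P :: "complex poly^'n^'n" where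
    "P = (\<chi> i j. if j = i0 then [:u $ i - l * v $ i, v $ i:] else [:f j $ i:])"
  \<comment> \<open>The square at \<open>i0\<close> is the surplus factor that will contradict the
    equality of multiplicities.\<close>
  define q where "q j = (if j = i0 then [:-l, 1:]\<^sup>2 else if j \<in> I then [:-l, 1:] else 1)" for j
  have Av: "(\<Sum>k\<in>UNIV. cmat A $ i $ k * v $ k) = u $ i + l * v $ i" for i
    by (simp add: u_def matrix_vector_mult_def)
  have Au: "(\<Sum>k\<in>UNIV. cmat A $ i $ k * u $ k) = l * u $ i" for i
    using uS by (simp add: S_def vec_eq_iff matrix_vector_mult_def)
  have Af: "(\<Sum>k\<in>UNIV. cmat A $ i $ k * f j $ k) = l * f j $ i" if "j \<in> I" for i j
    using that B0(2) by (auto simp: I_def S_def vec_eq_iff matrix_vector_mult_def)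
  have expand: "(char_matrix A ** P) $ i $ j
      = [:0, 1:] * P $ i $ j - (\<Sum>k\<in>UNIV. [:cmat A $ i $ k:] * P $ k $ j)" for i j
    by (simp add: char_matrix_def matrix_matrix_mult_def left_diff_distrib sum_subtractf
        if_distrib[of "\<lambda>a. a * _"] cong: if_cong)
  have sum_pCons: "(\<Sum>k\<in>X. [:a k, b k:]) = [:\<Sum>k\<in>X. a k, \<Sum>k\<in>X. b k:]"
    if "finite X" for X :: "'n set" and a b :: "'n \<Rightarrow> complex"
    using that by induction auto
  have sum_pCons0: "(\<Sum>k\<in>X. [:a k:]) = [:\<Sum>k\<in>X. a k:]"
    if "finite X" for X :: "'n set" and a :: "'n \<Rightarrow> complex"
    using that by induction auto
  have "q j dvd (char_matrix A ** P) $ i $ j" for i j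
  proof -
    consider "j = i0" | "j \<noteq> i0" "j \<in> I" | "j \<noteq> i0" "j \<notin> I" by blast
    then show ?thesis
    proof cases
      case 1
      have s: "(\<Sum>k\<in>UNIV. [:cmat A $ i $ k:] * P $ k $ j)
          = [:l * u $ i - l * (u $ i + l * v $ i), u $ i + l * v $ i:]"
      proof -
        have "(\<Sum>k\<in>UNIV. [:cmat A $ i $ k:] * P $ k $ j)
            = (\<Sum>k\<in>UNIV. [:cmat A $ i $ k * u $ k - l * (cmat A $ i $ k * v $ k), cmat A $ i $ k * v $ k:])"
          using 1 by (simp add: P_def algebra_simps)
        then show ?thesis
          by (simp add: sum_pCons sum_subtractf Av Au flip: sum_distrib_left)
      qed
      \<comment> \<open>Since \<open>A v = l v + u\<close> and \<open>A u = l u\<close>, (x - A) ((x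
        - l) v + u) = (x - l) (x v - l v - u) + (x - l) u = (x - l)^2 v.\<close>
      have "(char_matrix A ** P) $ i $ j = [:-l, 1:]\<^sup>2 * [:v $ i:]"
        unfolding expand s using 1 by (simp add: P_def power2_eq_square algebra_simps)
      then show ?thesis using 1 by (simp add: q_def del: mult_pCons_right)
    next
      case 2
      have s: "(\<Sum>k\<in>UNIV. [:cmat A $ i $ k:] * P $ k $ j) = [:l * f j $ i:]"
        using 2 Af[of j i] by (simp add: P_def sum_pCons0 mult.commute)
      have "(char_matrix A ** P) $ i $ j = [:-l, 1:] * [:f j $ i:]"
        unfolding expand s using 2 by (simp add: P_def)
      moreover have "q j = [:-l, 1:]" using 2 by (simp add: q_def)
      ultimately show ?thesis by (metis dvd_triv_left)
    next
      case 3
      then show ?thesis by (simp add: q_def)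
    qed
  qed
  then have "(\<Prod>j\<in>UNIV. q j) dvd det (char_matrix A ** P)"
    by (rule prod_dvd_det_of_columns)
  also have "\<dots> = charpoly A * det P"
    by (simp add: det_mul charpoly_def char_matrix_def)
  also have "(\<Prod>j\<in>UNIV. q j) = [:-l, 1:] ^ Suc (geom_mult A l)"
  proof -
    have "(\<Prod>j\<in>UNIV. q j) = (\<Prod>j\<in>I. q j)"
      by (rule prod.mono_neutral_right) (use i0 in \<open>auto simp: q_def\<close>)
    also have "\<dots> = q i0 * (\<Prod>j\<in>I - {i0}. q j)"
      using i0 by (simp add: prod.remove)
    also have "(\<Prod>j\<in>I - {i0}. q j) = [:-l, 1:] ^ (geom_mult A l - 1)"
      using i0 cardI by (simp add: q_def)
    finally have *: "(\<Prod>j\<in>UNIV. q j) = [:-l, 1:]\<^sup>2 * [:-l, 1:] ^ (geom_mult A l - 1)"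
      by (simp add: q_def)
    \<comment> \<open>Guards the truncated subtraction in the exponent.\<close>
    have "geom_mult A l > 0"
      using cardI i0 by (metis card_gt_0_iff empty_iff finite)
    then have "2 + (geom_mult A l - 1) = Suc (geom_mult A l)"
      by simp
    then show ?thesis unfolding * by (metis power_add)
  qed
  finally have dvd: "[:-l, 1:] ^ Suc (geom_mult A l) dvd charpoly A * det P" .
  \<comment> \<open>At x = l the modified column is \<open>u = f i0\<close> again, so the columns of
    \<open>P\<close> evaluate to the basis \<open>f\<close>.\<close>
  have "poly (det P) l = det (\<chi> i j. f j $ i)"
    unfolding poly_det by (rule arg_cong[where f = det]) (auto simp: vec_eq_iff P_def i0)
  also have "\<dots> \<noteq> 0"
    using f B1(3) by (intro det_columns_basis_nonzero) (simp add: bij_betw_def)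
  finally have detP: "poly (det P) l \<noteq> 0" .
  then have "det P \<noteq> 0" by auto
  then have "Suc (geom_mult A l) \<le> order l (charpoly A * det P)"
    using nz dvd order_divides by (metis mult_eq_0_iff)
  also have "\<dots> = order l (charpoly A)"
    using nz \<open>det P \<noteq> 0\<close> detP by (simp add: order_mult order_0I)
  finally show False
    using mult by (simp add: alg_mult_def)
qed

section \<open>Orbits and eigenvalues\<close>

lemma norm_vector_scalar_mult: "norm (c *s v) = cmod c * norm v" for v :: "complex^'n"
  by (simp add: norm_vec_def norm_mult L2_set_right_distrib)

section \<open>Polynomials of a matrix applied to a vector, p(T) v\<close>

definition poly_action :: "complex^'n^'n \<Rightarrow> complex poly \<Rightarrow> complex^'n \<Rightarrow> complex^'n" where
  "poly_action T p v = (\<Sum>i\<le>degree p. coeff p i *s ((*v) T ^^ i) v)"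

lemma poly_action_bound:
  assumes "degree p \<le> N"
  shows "poly_action T p v = (\<Sum>i\<le>N. coeff p i *s ((*v) T ^^ i) v)"
  unfolding poly_action_def
  by (rule sum.mono_neutral_left) (use assms in \<open>auto simp: coeff_eq_0\<close>)

lemma poly_action_const [simp]: "poly_action T [:c:] v = c *s v"
  by (simp add: poly_action_def)

lemma poly_action_add:
  "poly_action T (p + q) v = poly_action T p v + poly_action T q v"
  by (simp add: poly_action_bound[of _ "max (degree p) (degree q)"] degree_add_le_max
      vec.scale_left_distrib sum.distrib)

lemma matrix_vector_sum: "T *v (\<Sum>i\<in>I. g i) = (\<Sum>i\<in>I. T *v g i)" for T :: "'a::field^'n^'m"
  by (induction I rule: infinite_finite_induct) (auto simp: matrix_vector_right_distrib)

lemma poly_action_smult: "poly_action T (smult c p) v = c *s poly_action T p v"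
  by (simp add: poly_action_bound[of _ "degree p"] degree_smult_le vec.scale_sum_right
      vector_smult_assoc)

lemma poly_action_pCons_0: "poly_action T (pCons 0 p) v = T *v poly_action T p v"
  by (simp add: poly_action_bound[of _ "Suc (degree p)"] poly_action_def[of T p] degree_pCons_le sum.atMost_Suc_shift
      matrix_vector_sum vector_scalar_commute del: sum.atMost_Suc)

lemma poly_action_linear_factor:
  "poly_action T ([:-l, 1:] * p) v = T *v poly_action T p v - l *s poly_action T p v"
proof -
  have "[:-l, 1:] * p = pCons 0 p + smult (-l) p" by simp
  then show ?thesis
    by (simp add: poly_action_add poly_action_smult poly_action_pCons_0 vec.scale_minus_left
        del: smult_minus_left)
qed

lemma funpow_matrix_sum:
  "((*v) T ^^ n) (v + w) = ((*v) T ^^ n) v + ((*v) T ^^ n) w"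
  "((*v) T ^^ n) (c *s v) = c *s ((*v) T ^^ n) v" for T :: "'a::field^'n^'n"
  by (induction n) (auto simp: matrix_vector_right_distrib vector_scalar_commute)

lemma poly_action_vec_linear:
  "poly_action T p (v + w) = poly_action T p v + poly_action T p w"
  "poly_action T p (c *s v) = c *s poly_action T p v"
  by (simp_all add: poly_action_def funpow_matrix_sum vec.scale_right_distrib sum.distrib
      vec.scale_sum_right vector_smult_assoc mult.commute)

lemma poly_action_commute: "poly_action T p (T *v v) = T *v poly_action T p v"
  by (simp add: poly_action_def matrix_vector_sum vector_scalar_commute flip: funpow_swap1)

lemma poly_action_commute_factor:
  "poly_action T p (T *v v - l *s v) = T *v poly_action T p v - l *s poly_action T p v"
proof -
  have "T *v v - l *s v = T *v v + (- l) *s v" by (simp add: vec.scale_minus_left)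
  then show ?thesis
    by (simp only: poly_action_vec_linear poly_action_commute) (simp add: vec.scale_minus_left)
qed

lemma poly_action_poly_action:
  "poly_action T q (poly_action T r w) = poly_action T r (poly_action T q w)"
proof -
  have pow: "poly_action T q (((*v) T ^^ i) w) = ((*v) T ^^ i) (poly_action T q w)" for i
    by (induction i) (auto simp: poly_action_commute)
  have "poly_action T q 0 = 0"
    using poly_action_vec_linear(2)[of T q 0 0] by simp
  then have "poly_action T q (\<Sum>i\<in>I. g i) = (\<Sum>i\<in>I. poly_action T q (g i))" for I :: "nat set" and g
    by (induction I rule: infinite_finite_induct) (auto simp: poly_action_vec_linear)
  then show ?thesis
    by (simp add: poly_action_def[of T r] poly_action_vec_linear pow)
qed

text \<open>One more iterate than the dimension cannot be independent. Dependence is a property of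
  sets, so coinciding iterates form a case of their own, settled by a difference of two
  monomials.\<close>

lemma annihilating_poly_exists:
  fixes T :: "complex^'n^'n"
  shows "\<exists>p. p \<noteq> 0 \<and> poly_action T p v = 0"
proof (cases "inj_on (\<lambda>i. ((*v) T ^^ i) v) {..CARD('n)}")
  case True
  define b where "b i = ((*v) T ^^ i) v" for i
  have inj: "inj_on b {..CARD('n)}" using True by (simp add: b_def[abs_def])
  have "vec.dependent (b ` {..CARD('n)})"
  proof (rule ccontr)
    assume "\<not> vec.dependent (b ` {..CARD('n)})"
    then have "card (b ` {..CARD('n)}) \<le> CARD('n)"
      using vec.independent_card_le_dim[of "b ` {..CARD('n)}" UNIV] by (simp add: card_cart_basis)
    then show False using inj by (simp add: card_image)
  qed
  then obtain u w where u: "(\<Sum>x\<in>b ` {..CARD('n)}. u x *s x) = 0" "w \<le> CARD('n)" "u (b w) \<noteq> 0"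
    by (auto simp: vec.dependent_finite)
  define p where "p = (\<Sum>i\<le>CARD('n). monom (u (b i)) i)"
  have c: "coeff p i = (if i \<le> CARD('n) then u (b i) else 0)" for i
    by (simp add: p_def coeff_sum)
  have "degree p \<le> CARD('n)"
    by (rule degree_le) (auto simp: c)
  then have "poly_action T p v = (\<Sum>i\<le>CARD('n). u (b i) *s b i)"
    by (simp add: poly_action_bound c b_def)
  also have "\<dots> = 0"
    using u(1) inj by (simp add: sum.reindex)
  finally have "poly_action T p v = 0" .
  moreover have "p \<noteq> 0" using c[of w] u by auto
  ultimately show ?thesis by blast
next
  case False
  then obtain i j where ij: "i < j" "((*v) T ^^ i) v = ((*v) T ^^ j) v"
    unfolding inj_on_def by (metis (mono_tags, lifting) linorder_neqE_nat)
  define p :: "complex poly" where "p = monom 1 j - monom 1 i"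
  have "coeff p j \<noteq> 0" using ij by (simp add: p_def)
  then have "p \<noteq> 0" by auto
  moreover have "poly_action T p v = 0"
  proof -
    have "degree p \<le> j"
      unfolding p_def using ij by (intro degree_diff_le) (simp_all add: degree_monom_eq)
    then have "poly_action T p v
        = (\<Sum>k\<le>j. (if j = k then ((*v) T ^^ k) v else 0) - (if i = k then ((*v) T ^^ k) v else 0))"
      by (auto simp: poly_action_bound p_def vec.scale_left_diff_distrib intro!: sum.cong)
    also have "\<dots> = 0"
      using ij by (simp add: sum_subtractf)
    finally show ?thesis .
  qed
  ultimately show ?thesis by blast
qed

text \<open>Induction on the degree of a polynomial annihilating \<open>v\<close>, splitting off one
  root at a time. Keeping \<open>good\<close> abstract lets the same induction yield boundedness of
  orbits and geometric decay.\<close>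

lemma orbit_property_from_eigenvalues:
  fixes T :: "complex^'n^'n"
  assumes semisimple: "\<And>l v. cmod l = 1 \<Longrightarrow>
      T *v (T *v v - l *s v) = l *s (T *v v - l *s v) \<Longrightarrow> T *v v = l *s v"
    and disk: "\<And>l v. v \<noteq> 0 \<Longrightarrow> T *v v = l *s v \<Longrightarrow> cmod l \<le> 1"
    and add: "\<And>v w. good v \<Longrightarrow> good w \<Longrightarrow> good (v + w)"
    and scale: "\<And>c v. good v \<Longrightarrow> good (c *s v)"
    and eigen: "\<And>l v. cmod l = 1 \<Longrightarrow> T *v v = l *s v \<Longrightarrow> good v"
    and inside: "\<And>l v. cmod l < 1 \<Longrightarrow> good (T *v v - l *s v) \<Longrightarrow> good v"
  shows "good v"
proof -
  have zero: "good 0"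
    using eigen[of 1 0] by simp
  have "p \<noteq> 0 \<Longrightarrow> poly_action T p v = 0 \<Longrightarrow> good v" for p
  proof (induction "degree p" arbitrary: p v rule: less_induct)
    case less
    show ?case
    proof (cases "degree p = 0")
      case True
      then obtain c where "p = [:c:]" by (meson degree_eq_zeroE)
      then show ?thesis using less.prems zero by (simp add: vec.scale_eq_0_iff)
    next
      case False
      then obtain l where "poly p l = 0"
        by (metis fundamental_theorem_of_algebra constant_degree)
      then obtain q where q: "p = [:-l, 1:] * q"
        by (meson poly_eq_0_iff_dvd dvdE)
      have "q \<noteq> 0" using q less.prems by auto
      have "degree p = degree [:-l, 1:] + degree q"
        unfolding q using \<open>q \<noteq> 0\<close> by (intro degree_mult_eq) auto
      then have deg: "degree q < degree p" by simp
      have ker: "T *v poly_action T q v = l *s poly_action T q v"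
        using less.prems(2) unfolding q poly_action_linear_factor by simp
      have "cmod l \<le> 1 \<or> poly_action T q v = 0"
        using disk ker by blast
      then consider "poly_action T q v = 0" | "cmod l < 1" | "cmod l = 1"
        by linarith
      then show ?thesis
      proof cases
        case 1
        then show ?thesis using less.hyps deg \<open>q \<noteq> 0\<close> by blast
      next
        case 2
        \<comment> \<open>The vector (T - l) v is annihilated by \<open>q\<close> alone, so it is
          good by induction and \<open>inside\<close> passes back to \<open>v\<close>.\<close>
        have "poly_action T q (T *v v - l *s v) = 0"
          using ker by (simp add: poly_action_commute_factor)
        then show ?thesis
          using less.hyps deg \<open>q \<noteq> 0\<close> inside 2 by blast
      next
        case 3
        show ?thesis
        proof (cases "poly q l = 0")
          case True
          then obtain r where r: "q = [:-l, 1:] * r"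
            by (meson poly_eq_0_iff_dvd dvdE)
          \<comment> \<open>A double root on the unit circle: semisimplicity turns (T - l)^2 r(T) v
            = 0 into (T - l) r(T) v = 0, so already \<open>q\<close> annihilates
            \<open>v\<close>.\<close>
          have "T *v poly_action T r v = l *s poly_action T r v"
            using semisimple[OF 3, of "poly_action T r v"] ker
            unfolding r poly_action_linear_factor by blast
          then have "poly_action T q v = 0"
            unfolding r poly_action_linear_factor by simp
          then show ?thesis using less.hyps deg \<open>q \<noteq> 0\<close> by blast
        next
          case False
          have "poly (q - [:poly q l:]) l = 0" by simp
          then obtain r where "q - [:poly q l:] = [:-l, 1:] * r"
            by (meson poly_eq_0_iff_dvd dvdE)
          \<comment> \<open>Division with remainder at a simple root writes q(l) v = q(T) v - r(T)
            (T - l) v, an eigenvector minus a vector annihilated by \<open>q\<close>.\<close>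
          then have r: "q = [:poly q l:] + [:-l, 1:] * r"
            by (metis add.commute diff_add_cancel)
          define y where "y = poly_action T r (T *v v - l *s v)"
          have y: "poly_action T q v = poly q l *s v + y"
            by (subst r) (simp add: poly_action_add poly_action_linear_factor y_def
                poly_action_commute_factor del: mult_pCons_left)
          have "good (poly_action T q v)"
            by (rule eigen[OF 3 ker])
          moreover have "good y"
          proof -
            have "poly_action T q (T *v v - l *s v) = 0"
              using ker by (simp add: poly_action_commute_factor)
            moreover have "poly_action T r 0 = 0"
              using poly_action_vec_linear(2)[of T r 0 0] by simp
            ultimately have "poly_action T q y = 0"
              by (simp add: y_def poly_action_poly_action[of T q])
            then show ?thesis using less.hyps deg \<open>q \<noteq> 0\<close> by blast
          qed
          ultimately have "good ((1 / poly q l) *s (poly_action T q v + (-1) *s y))"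
            by (intro add scale)
          also have "(1 / poly q l) *s (poly_action T q v + (-1) *s y) = v"
            using False by (simp add: y vector_smult_assoc vec.scale_minus_left)
          finally show ?thesis .
        qed
      qed
    qed
  qed
  then show ?thesis using annihilating_poly_exists by blast
qed

text \<open>The norms of the iterates satisfy a(n+1) <= |l| a(n) + C \<theta>^n, and a geometric
  rate strictly above |l| survives this recursion.\<close>

lemma orbit_bound_of_contracting_factor:
  fixes T :: "complex^'n^'n"
  assumes l: "cmod l < \<theta>"
    and b: "\<And>n. norm (((*v) T ^^ n) (T *v v - l *s v)) \<le> C * \<theta> ^ n"
  shows "\<exists>C. \<forall>n. norm (((*v) T ^^ n) v) \<le> C * \<theta> ^ n"
proof -
  \<comment> \<open>The second entry is what makes C + |l| D <= \<theta> D; the first one starts the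
    induction.\<close>
  define D where "D = max (norm v) (C / (\<theta> - cmod l))"
  have "\<theta> > 0" using l norm_ge_zero[of l] by linarith
  have D: "C \<le> D * (\<theta> - cmod l)"
    using l by (simp add: D_def pos_divide_le_eq[symmetric])
  have "norm (((*v) T ^^ n) v) \<le> D * \<theta> ^ n" for n
  proof (induction n)
    case 0
    show ?case by (simp add: D_def)
  next
    case (Suc n)
    have "((*v) T ^^ n) (T *v v - l *s v) + l *s ((*v) T ^^ n) v = ((*v) T ^^ Suc n) v"
      by (simp add: funpow_swap1 flip: funpow_matrix_sum)
    then have "norm (((*v) T ^^ Suc n) v)
        \<le> norm (((*v) T ^^ n) (T *v v - l *s v)) + cmod l * norm (((*v) T ^^ n) v)"
      by (metis norm_triangle_ineq norm_vector_scalar_mult)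
    also have "\<dots> \<le> C * \<theta> ^ n + cmod l * (D * \<theta> ^ n)"
      using b Suc by (intro add_mono mult_left_mono) auto
    also have "\<dots> \<le> D * (\<theta> - cmod l) * \<theta> ^ n + cmod l * (D * \<theta> ^ n)"
      using D \<open>\<theta> > 0\<close> by (intro add_right_mono mult_right_mono) auto
    also have "\<dots> = D * \<theta> ^ Suc n"
      by (simp add: algebra_simps)
    finally show ?case .
  qed
  then show ?thesis by blast
qed

section \<open>Orbits of real matrices through complexification\<close>

definition cvec :: "real^'n \<Rightarrow> complex^'n" where
  "cvec x = (\<chi> i. complex_of_real (x $ i))"

lemma norm_cvec: "norm (cvec x) = norm x"
  by (simp add: norm_vec_def cvec_def)

lemma cmat_mult_cvec: "cmat A *v cvec x = cvec (A *v x)"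
  by (simp add: vec_eq_iff cvec_def cmat_def matrix_vector_mult_def)

lemma funpow_cmat_cvec: "((*v) (cmat A) ^^ n) (cvec x) = cvec (((*v) A ^^ n) x)"
  by (induction n) (auto simp: cmat_mult_cvec)

proposition orbits_bounded:
  fixes A :: "real^'n^'n"
  assumes eig_disk: "\<And>l. is_eigenvalue A l \<Longrightarrow> cmod l \<le> 1"
    and eig_unit: "\<And>l. is_eigenvalue A l \<Longrightarrow> cmod l = 1 \<Longrightarrow> alg_mult A l = geom_mult A l"
  shows "\<exists>C. \<forall>n. norm (((*v) A ^^ n) x) \<le> C"
proof -
  \<comment> \<open>The factor \<open>1 ^ n\<close> gives boundedness the form of a geometric bound
    with rate 1.\<close>
  define good where "good v \<longleftrightarrow> (\<exists>C. \<forall>n. norm (((*v) (cmat A) ^^ n) v) \<le> C * 1 ^ n)" for v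
  have "\<not> is_eigenvalue A 2"
    using eig_disk[of 2] by auto
  then have nz: "charpoly A \<noteq> 0" by (rule charpoly_nonzero)
  have "good (cvec x)"
  proof (rule orbit_property_from_eigenvalues[where T = "cmat A"])
    fix l v assume *: "cmod l = 1" "cmat A *v (cmat A *v v - l *s v) = l *s (cmat A *v v - l *s v)"
    show "cmat A *v v = l *s v"
    proof (cases "is_eigenvalue A l")
      case True
      show ?thesis using semisimple_eigenvalue[OF eig_unit[OF True *(1)] nz *(2)] .
    next
      case False
      \<comment> \<open>If \<open>l\<close> is no eigenvalue, the assumed eigenvector equation for
        (A - l) v already forces that vector to vanish.\<close>
      then have "cmat A *v v - l *s v = 0" using *(2) unfolding is_eigenvalue_def by blast
      then show ?thesis by simp
    qed
  next
    show "cmod l \<le> 1" if "v \<noteq> 0" "cmat A *v v = l *s v" for l v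
      using eig_disk that unfolding is_eigenvalue_def by blast
  next
    fix v w assume "good v" "good w"
    then obtain C D where "\<forall>n. norm (((*v) (cmat A) ^^ n) v) \<le> C" "\<forall>n. norm (((*v) (cmat A) ^^ n) w) \<le> D"
      by (auto simp: good_def)
    then have "\<forall>n. norm (((*v) (cmat A) ^^ n) (v + w)) \<le> C + D"
      unfolding funpow_matrix_sum by (meson add_mono norm_triangle_ineq order_trans)
    then show "good (v + w)" by (auto simp: good_def)
  next
    fix c v assume "good v"
    then obtain C where "\<forall>n. norm (((*v) (cmat A) ^^ n) v) \<le> C"
      by (auto simp: good_def)
    then have "\<forall>n. norm (((*v) (cmat A) ^^ n) (c *s v)) \<le> cmod c * C"
      by (auto simp: funpow_matrix_sum norm_vector_scalar_mult intro!: mult_left_mono)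
    then show "good (c *s v)" by (auto simp: good_def)
  next
    fix l v assume *: "cmod l = 1" "cmat A *v v = l *s v"
    have "norm (((*v) (cmat A) ^^ n) v) = norm v" for n
    proof (induction n)
      case (Suc n)
      have "((*v) (cmat A) ^^ Suc n) v = l *s ((*v) (cmat A) ^^ n) v"
        unfolding funpow_Suc_right o_apply *(2) by (rule funpow_matrix_sum)
      then show ?case using Suc *(1) by (simp add: norm_vector_scalar_mult)
    qed simp
    then show "good v" by (auto simp: good_def)
  next
    fix l v assume "cmod l < 1" "good (cmat A *v v - l *s v)"
    then show "good v"
      using orbit_bound_of_contracting_factor[of l 1] unfolding good_def by blast
  qed
  then show ?thesis
    by (simp add: good_def funpow_cmat_cvec norm_cvec)
qed

text \<open>The induction is run on geometric decay with a rate depending on the vector, because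
  \<open>orbit_bound_of_contracting_factor\<close> transports rates; convergence is read off at the
  end.\<close>

proposition orbits_decay:
  fixes A :: "real^'n^'n"
  assumes eig: "\<And>l. is_eigenvalue A l \<Longrightarrow> cmod l < 1"
  shows "(\<lambda>n. ((*v) A ^^ n) x) \<longlonglongrightarrow> 0"
proof -
  define good where
    "good v \<longleftrightarrow> (\<exists>\<theta> C. 0 < \<theta> \<and> \<theta> < 1 \<and> (\<forall>n. norm (((*v) (cmat A) ^^ n) v) \<le> C * \<theta> ^ n))" for v
  have weaken: "\<forall>n. norm (((*v) (cmat A) ^^ n) v) \<le> \<bar>C\<bar> * \<theta>' ^ n"
    if "0 < \<theta>" "\<theta> \<le> \<theta>'" "\<forall>n. norm (((*v) (cmat A) ^^ n) v) \<le> C * \<theta> ^ n" for v C \<theta> \<theta>'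
  proof
    fix n
    have "norm (((*v) (cmat A) ^^ n) v) \<le> C * \<theta> ^ n" using that by blast
    also have "\<dots> \<le> \<bar>C\<bar> * \<theta>' ^ n" using that by (intro mult_mono power_mono) auto
    finally show "norm (((*v) (cmat A) ^^ n) v) \<le> \<bar>C\<bar> * \<theta>' ^ n" .
  qed
  have eigvec: "v = 0" if "cmat A *v v = l *s v" "cmod l \<ge> 1" for l v
    using eig[of l] that unfolding is_eigenvalue_def by force
  have funpow0: "((*v) (cmat A) ^^ n) 0 = 0" for n
    by (induction n) auto
  have "good (cvec x)"
  proof (rule orbit_property_from_eigenvalues[where T = "cmat A"])
    fix l v assume "cmod l = 1" "cmat A *v (cmat A *v v - l *s v) = l *s (cmat A *v v - l *s v)"
    then have "cmat A *v v - l *s v = 0" using eigvec by (metis order_refl)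
    then show "cmat A *v v = l *s v" by simp
  next
    show "cmod l \<le> 1" if "v \<noteq> 0" "cmat A *v v = l *s v" for l v
      using eigvec that by force
  next
    fix v w assume "good v" "good w"
    then obtain C D a b where ab: "0 < a" "a < 1" "\<forall>n. norm (((*v) (cmat A) ^^ n) v) \<le> C * a ^ n"
      "0 < b" "b < 1" "\<forall>n. norm (((*v) (cmat A) ^^ n) w) \<le> D * b ^ n"
      by (auto simp: good_def)
    define m where "m = max a b"
    have "norm (((*v) (cmat A) ^^ n) (v + w)) \<le> (\<bar>C\<bar> + \<bar>D\<bar>) * m ^ n" for n
    proof -
      have "norm (((*v) (cmat A) ^^ n) v) \<le> \<bar>C\<bar> * m ^ n" "norm (((*v) (cmat A) ^^ n) w) \<le> \<bar>D\<bar> * m ^ n"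
        using weaken[of a m v C] weaken[of b m w D] ab by (auto simp: m_def)
      then show ?thesis
        unfolding funpow_matrix_sum distrib_right by (meson add_mono norm_triangle_ineq order_trans)
    qed
    moreover have "0 < m" "m < 1" using ab by (auto simp: m_def)
    ultimately show "good (v + w)" unfolding good_def by blast
  next
    fix c v assume "good v"
    then obtain C a where a: "0 < a" "a < 1" "\<forall>n. norm (((*v) (cmat A) ^^ n) v) \<le> C * a ^ n"
      by (auto simp: good_def)
    then have "\<forall>n. norm (((*v) (cmat A) ^^ n) (c *s v)) \<le> (cmod c * C) * a ^ n"
      by (auto simp: funpow_matrix_sum norm_vector_scalar_mult mult.assoc intro!: mult_left_mono)
    then show "good (c *s v)" using a unfolding good_def by blast
  next
    fix l v assume "cmod l = 1" "cmat A *v v = l *s v"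
    then have "v = 0" using eigvec by force
    then show "good v" unfolding good_def by (intro exI[of _ "1/2"] exI[of _ 0]) (simp add: funpow0)
  next
    fix l v assume l: "cmod l < 1" and "good (cmat A *v v - l *s v)"
    then obtain C a where a: "0 < a" "a < 1"
        "\<forall>n. norm (((*v) (cmat A) ^^ n) (cmat A *v v - l *s v)) \<le> C * a ^ n"
      by (auto simp: good_def)
    \<comment> \<open>The midpoint between |l| and 1 lies strictly above |l|, as the recursion
      requires, and the maximum keeps the old rate valid.\<close>
    define m where "m = max a ((1 + cmod l) / 2)"
    have m: "cmod l < m" "m < 1" "a \<le> m" "0 < m" using a l by (auto simp: m_def less_max_iff_disj)
    have "\<exists>C. \<forall>n. norm (((*v) (cmat A) ^^ n) v) \<le> C * m ^ n"
      using orbit_bound_of_contracting_factor[OF m(1)] weaken[OF a(1) m(3) a(3)] by blast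
    then show "good v" using m unfolding good_def by blast
  qed
  then obtain C a where a: "0 < a" "a < 1" "\<And>n. norm (((*v) A ^^ n) x) \<le> C * a ^ n"
    by (auto simp: good_def funpow_cmat_cvec norm_cvec)
  have "(\<lambda>n. C * a ^ n) \<longlonglongrightarrow> C * 0"
    by (intro tendsto_mult_left LIMSEQ_power_zero) (use a in auto)
  then have "(\<lambda>n. C * a ^ n) \<longlonglongrightarrow> 0" by simp
  then show ?thesis
    by (rule Lim_null_comparison[rotated]) (use a(3) in auto)
qed

section \<open>The limit seminorm of a power bounded map\<close>

lemma linear_funpow: "linear f \<Longrightarrow> linear (f ^^ n)" for f :: "'a::real_vector \<Rightarrow> 'a"
  by (induction n) (auto simp: linear_id[unfolded id_def] id_def intro: linear_compose)

text \<open>In finite dimension it suffices to add up the bounds for the orbits of the basis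
  vectors.\<close>

lemma power_bounded_uniformly:
  fixes f :: "'a::euclidean_space \<Rightarrow> 'a"
  assumes "linear f" "\<And>x. \<exists>C. \<forall>n. norm ((f ^^ n) x) \<le> C"
  shows "\<exists>M. \<forall>n x. norm ((f ^^ n) x) \<le> M * norm x"
proof -
  obtain C where C: "\<And>x n. norm ((f ^^ n) x) \<le> C x"
    using assms(2) by metis
  have "norm ((f ^^ n) x) \<le> (\<Sum>b\<in>Basis. C b) * norm x" for n x
  proof -
    interpret linear "f ^^ n" by (rule linear_funpow[OF assms(1)])
    have "norm ((f ^^ n) x) = norm (\<Sum>b\<in>Basis. (x \<bullet> b) *\<^sub>R (f ^^ n) b)"
      by (subst euclidean_representation[of x, symmetric]) (simp add: sum scale)
    also have "\<dots> \<le> (\<Sum>b\<in>Basis. \<bar>x \<bullet> b\<bar> * norm ((f ^^ n) b))"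
      by (rule order_trans[OF norm_sum]) simp
    also have "\<dots> \<le> (\<Sum>b\<in>Basis. norm x * C b)"
      using C by (intro sum_mono mult_mono) (auto simp: Basis_le_norm)
    finally show ?thesis by (simp add: sum_distrib_left mult.commute)
  qed
  then show ?thesis by blast
qed

locale power_bounded_map =
  fixes f :: "'a::euclidean_space \<Rightarrow> 'a" and M :: real
  assumes linear: "linear f"
    and bounded: "norm ((f ^^ n) x) \<le> M * norm x"
begin

lemma M_ge_1: "1 \<le> M"
proof -
  obtain b :: 'a where "b \<in> Basis" using nonempty_Basis by blast
  then show ?thesis using bounded[of 0 b] by simp
qed

lemmas iter_add = linear_add[OF linear_funpow[OF linear]]
lemmas iter_diff = linear_diff[OF linear_funpow[OF linear]]
lemmas iter_scale = linear_scale[OF linear_funpow[OF linear]]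
lemmas iter_sum = linear_sum[OF linear_funpow[OF linear]]
lemmas iter_0 = linear_0[OF linear_funpow[OF linear]]

lemma iter_step: "(f ^^ n) (f x) = f ((f ^^ n) x)"
  by (rule funpow_swap1[symmetric])

text \<open>An equivalent norm for which \<open>f\<close> is nonexpansive; hence it is monotone
  along orbits and has a limit there.\<close>

definition orbit_norm :: "'a \<Rightarrow> real" where
  "orbit_norm x = (SUP n. norm ((f ^^ n) x))"

definition limit_norm :: "'a \<Rightarrow> real" where
  "limit_norm x = lim (\<lambda>n. orbit_norm ((f ^^ n) x))"

lemma bdd_orbit: "bdd_above (range (\<lambda>n. norm ((f ^^ n) x)))"
  using bounded by (intro bdd_aboveI2)

lemma iter_le_orbit_norm: "norm ((f ^^ n) x) \<le> orbit_norm x"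
  unfolding orbit_norm_def by (intro cSUP_upper bdd_orbit) auto

lemma orbit_normI: "(\<And>n. norm ((f ^^ n) x) \<le> c) \<Longrightarrow> orbit_norm x \<le> c"
  unfolding orbit_norm_def by (intro cSUP_least) auto

lemma norm_le_orbit_norm: "norm x \<le> orbit_norm x"
  using iter_le_orbit_norm[of 0 x] by simp

lemma orbit_norm_nonneg: "0 \<le> orbit_norm x"
  using norm_le_orbit_norm[of x] norm_ge_zero[of x] by linarith

lemma orbit_norm_le: "orbit_norm x \<le> M * norm x"
  by (rule orbit_normI[OF bounded])

lemma orbit_norm_step: "orbit_norm (f x) \<le> orbit_norm x"
  using iter_le_orbit_norm[of "Suc _" x] by (intro orbit_normI) (simp add: iter_step)

lemma orbit_norm_triangle: "orbit_norm (x + y) \<le> orbit_norm x + orbit_norm y"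
  by (rule orbit_normI)
     (simp add: iter_add order_trans[OF norm_triangle_ineq add_mono] iter_le_orbit_norm)

lemma orbit_norm_scale: "orbit_norm (c *\<^sub>R x) \<le> \<bar>c\<bar> * orbit_norm x"
  by (rule orbit_normI) (simp add: iter_scale iter_le_orbit_norm mult_left_mono)

lemma decseq_orbit_norm: "decseq (\<lambda>n. orbit_norm ((f ^^ n) x))"
  by (rule decseq_SucI) (simp add: orbit_norm_step)

lemma limit_norm_tendsto: "(\<lambda>n. orbit_norm ((f ^^ n) x)) \<longlonglongrightarrow> limit_norm x"
proof -
  obtain L where "(\<lambda>n. orbit_norm ((f ^^ n) x)) \<longlonglongrightarrow> L"
    using decseq_convergent[OF decseq_orbit_norm, of 0 x] orbit_norm_nonneg by blast
  then show ?thesis unfolding limit_norm_def by (simp add: limI)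
qed

lemma limit_norm_nonneg: "0 \<le> limit_norm x"
  using limit_norm_tendsto by (rule LIMSEQ_le_const) (auto simp: orbit_norm_nonneg)

lemma limit_norm_le: "limit_norm x \<le> M * norm x"
  using decseq_ge[OF decseq_orbit_norm limit_norm_tendsto, of x 0] orbit_norm_le[of x] by simp

lemma limit_norm_step [simp]: "limit_norm (f x) = limit_norm x"
proof (rule LIMSEQ_unique)
  show "(\<lambda>n. orbit_norm ((f ^^ Suc n) x)) \<longlonglongrightarrow> limit_norm (f x)"
    using limit_norm_tendsto[of "f x"] by (simp add: iter_step)
  show "(\<lambda>n. orbit_norm ((f ^^ Suc n) x)) \<longlonglongrightarrow> limit_norm x"
    using limit_norm_tendsto by (rule LIMSEQ_Suc)
qed

lemma limit_norm_iter [simp]: "limit_norm ((f ^^ n) x) = limit_norm x"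
  by (induction n) auto

lemma limit_norm_triangle: "limit_norm (x + y) \<le> limit_norm x + limit_norm y"
  by (rule LIMSEQ_le[OF limit_norm_tendsto tendsto_add[OF limit_norm_tendsto limit_norm_tendsto]])
     (auto simp: iter_add orbit_norm_triangle)

lemma limit_norm_scale: "limit_norm (c *\<^sub>R x) \<le> \<bar>c\<bar> * limit_norm x"
  by (rule LIMSEQ_le[OF limit_norm_tendsto tendsto_mult_left[OF limit_norm_tendsto]])
     (auto simp: iter_scale orbit_norm_scale)

lemma limit_norm_0 [simp]: "limit_norm 0 = 0"
  using limit_norm_le[of 0] limit_norm_nonneg[of 0] by simp

lemma limit_norm_minus: "limit_norm (- x) = limit_norm x"
  using limit_norm_scale[of "-1" x] limit_norm_scale[of "-1" "-x"] by simp

lemma limit_norm_diff: "limit_norm (x - y) \<le> limit_norm x + limit_norm y"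
  using limit_norm_triangle[of x "- y"] by (simp add: limit_norm_minus)

lemma limit_norm_sum: "limit_norm (\<Sum>i\<in>I. g i) \<le> (\<Sum>i\<in>I. limit_norm (g i))"
  by (induction I rule: infinite_finite_induct) (auto intro: order_trans[OF limit_norm_triangle])

lemma limit_norm_cong_null: "limit_norm (x - y) = 0 \<Longrightarrow> limit_norm x = limit_norm y"
  using limit_norm_triangle[of "x - y" y] limit_norm_diff[of x "x - y"] by simp

section \<open>The null space of the limit seminorm and a complement\<close>

lemma continuous_on_limit_norm: "continuous_on S limit_norm"
proof (rule continuous_on_subset[OF lipschitz_on_continuous_on])
  show "M-lipschitz_on UNIV limit_norm"
  proof (rule lipschitz_onI)
    fix x y
    have "limit_norm x \<le> limit_norm y + limit_norm (x - y)" "limit_norm y \<le> limit_norm x + limit_norm (x - y)"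
      using limit_norm_triangle[of y "x - y"] limit_norm_diff[of x "x - y"] by simp_all
    then show "dist (limit_norm x) (limit_norm y) \<le> M * dist x y"
      using limit_norm_le[of "x - y"] by (simp add: dist_norm)
  qed (use M_ge_1 in auto)
qed auto

lemma limit_norm_eq_0_iff: "limit_norm x = 0 \<longleftrightarrow> (\<lambda>n. (f ^^ n) x) \<longlonglongrightarrow> 0"
proof
  assume "limit_norm x = 0"
  then have "(\<lambda>n. orbit_norm ((f ^^ n) x)) \<longlonglongrightarrow> 0"
    using limit_norm_tendsto[of x] by simp
  then show "(\<lambda>n. (f ^^ n) x) \<longlonglongrightarrow> 0"
    by (rule Lim_null_comparison[rotated]) (auto simp: norm_le_orbit_norm)
next
  assume "(\<lambda>n. (f ^^ n) x) \<longlonglongrightarrow> 0"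
  then have "(\<lambda>n. M * norm ((f ^^ n) x)) \<longlonglongrightarrow> 0"
    by (intro tendsto_mult_right_zero tendsto_norm_zero)
  then have "(\<lambda>n. orbit_norm ((f ^^ n) x)) \<longlonglongrightarrow> 0"
    by (rule Lim_null_comparison[rotated]) (auto simp: orbit_norm_le orbit_norm_nonneg)
  then show "limit_norm x = 0"
    using LIMSEQ_unique limit_norm_tendsto by blast
qed

lemma subspace_limit_norm_null: "subspace {x. limit_norm x = 0}"
proof (rule subspaceI)
  fix x y and c :: real assume "x \<in> {x. limit_norm x = 0}"
  then show "c *\<^sub>R x \<in> {x. limit_norm x = 0}"
    using limit_norm_scale[of c x] limit_norm_nonneg[of "c *\<^sub>R x"] by simp
  assume "y \<in> {x. limit_norm x = 0}"
  with \<open>x \<in> {x. limit_norm x = 0}\<close> show "x + y \<in> {x. limit_norm x = 0}"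
    using limit_norm_triangle[of x y] limit_norm_nonneg[of "x + y"] by simp
qed simp

text \<open>\<open>P\<close> is the orthogonal projection onto the complement \<open>Z\<close> of
  the null space, a concrete model of the quotient. On \<open>Z\<close> the seminorm is a norm, so
  its minimum over the unit sphere of \<open>Z\<close> is positive and yields
  \<open>C\<close>.\<close>

lemma projection_exists:
  obtains P :: "'a \<Rightarrow> 'a" and C where
    "linear P" "\<And>x. limit_norm (x - P x) = 0" "C \<ge> 0" "\<And>x. norm (P x) \<le> C * limit_norm x"
proof -
  define X where "X = {x. limit_norm x = 0}"
  define Z where "Z = {z. \<forall>x\<in>X. orthogonal z x}"
  have "subspace X" unfolding X_def by (rule subspace_limit_norm_null)
  have "subspace Z"
    by (rule subspaceI) (auto simp: Z_def orthogonal_clauses)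
  then obtain B where B: "B \<subseteq> Z" "pairwise orthogonal B" "\<And>x. x \<in> B \<Longrightarrow> norm x = 1"
      "independent B" "card B = dim Z" "span B = Z"
    by (rule orthonormal_basis_subspace) auto
  have "finite B" using B(4) by (rule independent_imp_finite)
  define P where "P x = (\<Sum>b\<in>B. (x \<bullet> b) *\<^sub>R b)" for x
  have linP: "linear P"
    unfolding P_def by (intro linearI) (auto simp: inner_add_left algebra_simps sum.distrib scaleR_sum_right)
  have PZ: "P x \<in> Z" for x
    unfolding P_def using \<open>subspace Z\<close> B(1) by (intro subspace_sum subspace_scale) auto
  have null: "limit_norm (x - P x) = 0" for x
  proof -
    obtain y z where "y \<in> span X" "\<And>w. w \<in> span X \<Longrightarrow> orthogonal z w" "x = y + z"
      using orthogonal_subspace_decomp_exists[of X x] by blast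
    moreover have "span X = X" using \<open>subspace X\<close> by (simp add: span_eq_iff)
    ultimately have yz: "y \<in> X" "z \<in> Z" "x = y + z" by (auto simp: Z_def)
    have "P y = 0"
      unfolding P_def using B(1) yz(1) by (intro sum.neutral) (auto simp: Z_def orthogonal_def inner_commute)
    moreover have "P z = z"
      unfolding P_def by (rule orthonormal_basis_expand[OF B(2,3)]) (use yz B \<open>finite B\<close> in auto)
    ultimately have "x - P x = y"
      using yz(3) linear_add[OF linP] by simp
    then show ?thesis using yz(1) by (simp add: X_def)
  qed
  have "\<exists>c>0. \<forall>z\<in>Z. c * norm z \<le> limit_norm z"
  \<comment> \<open>The sphere is empty if \<open>Z = {0}\<close>; then there is no minimum to take,
    and any constant works.\<close>
  proof (cases "sphere 0 1 \<inter> Z = {}")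
    case True
    have "z = 0" if "z \<in> Z" for z
    proof (rule ccontr)
      assume "z \<noteq> 0"
      then have "(1 / norm z) *\<^sub>R z \<in> sphere 0 1 \<inter> Z"
        using that \<open>subspace Z\<close> by (auto intro: subspace_scale)
      then show False using True by blast
    qed
    then have "\<forall>z\<in>Z. 1 * norm z \<le> limit_norm z" by (metis limit_norm_0 mult_1 norm_zero order_refl)
    then show ?thesis using zero_less_one by blast
  next
    case False
    have "compact (sphere 0 1 \<inter> Z)"
      by (intro compact_Int_closed compact_sphere closed_subspace \<open>subspace Z\<close>)
    then obtain m where m: "m \<in> sphere 0 1 \<inter> Z" "\<And>z. z \<in> sphere 0 1 \<inter> Z \<Longrightarrow> limit_norm m \<le> limit_norm z"
      using continuous_attains_inf[OF _ False continuous_on_limit_norm] by blast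
    have "limit_norm m \<noteq> 0"
    proof
      assume "limit_norm m = 0"
      then have "orthogonal m m" using m(1) by (auto simp: Z_def X_def)
      then show False using m(1) by (auto simp: orthogonal_def)
    qed
    then have pos: "limit_norm m > 0" using limit_norm_nonneg[of m] by linarith
    have "limit_norm m * norm z \<le> limit_norm z" if "z \<in> Z" for z
    proof (cases "z = 0")
      case False
      have "(1 / norm z) *\<^sub>R z \<in> sphere 0 1 \<inter> Z"
        using that False \<open>subspace Z\<close> by (auto intro: subspace_scale)
      then have "limit_norm m \<le> limit_norm ((1 / norm z) *\<^sub>R z)" by (rule m(2))
      also have "\<dots> \<le> (1 / norm z) * limit_norm z" using limit_norm_scale[of "1 / norm z" z] by simp
      finally show ?thesis using False by (simp add: field_simps)
    qed simp
    then show ?thesis using pos by blast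
  qed
  then obtain c where c: "c > 0" "\<And>z. z \<in> Z \<Longrightarrow> c * norm z \<le> limit_norm z" by blast
  have "norm (P x) \<le> (1 / c) * limit_norm x" for x
  proof -
    have "c * norm (P x) \<le> limit_norm (P x)" using c(2) PZ by blast
    also have "limit_norm (P x) = limit_norm x" using limit_norm_cong_null[OF null] by simp
    finally show ?thesis using c(1) by (simp add: field_simps)
  qed
  then show ?thesis
    using that[OF linP null, of "1 / c"] c(1) by simp
qed

text \<open>The vectors \<open>b - P b\<close> for basis vectors \<open>b\<close> are null, so
  finitely many convergent orbits decide how large \<open>N\<close> must be; the part
  \<open>P x\<close> is paid for by the seminorm.\<close>

lemma contraction_modulo_limit_norm:
  obtains N C where "N \<ge> 1" "C \<ge> 0" "\<And>x. norm ((f ^^ N) x) \<le> norm x / 2 + C * limit_norm x"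
proof -
  obtain P C where P: "linear P" "\<And>x. limit_norm (x - P x) = 0" "C \<ge> 0" "\<And>x. norm (P x) \<le> C * limit_norm x"
    by (rule projection_exists) blast
  have "(\<lambda>n. \<Sum>b\<in>Basis. norm ((f ^^ n) (b - P b))) \<longlonglongrightarrow> 0"
    by (intro tendsto_null_sum tendsto_norm_zero) (use P(2) in \<open>simp add: limit_norm_eq_0_iff\<close>)
  then have "\<forall>\<^sub>F n in sequentially. (\<Sum>b\<in>Basis. norm ((f ^^ n) (b - P b))) < 1/2"
    by (rule order_tendstoD) simp
  then have "\<forall>\<^sub>F n in sequentially. n \<ge> 1 \<and> (\<Sum>b\<in>Basis. norm ((f ^^ n) (b - P b))) < 1/2"
    using eventually_ge_at_top by (rule eventually_conj[rotated])
  then obtain N where N: "N \<ge> 1" "(\<Sum>b\<in>Basis. norm ((f ^^ N) (b - P b))) < 1/2"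
    by (metis (mono_tags, lifting) eventually_happens sequentially_bot)
  have "norm ((f ^^ N) x) \<le> norm x / 2 + (M * C) * limit_norm x" for x
  proof -
    have "x - P x = (\<Sum>b\<in>Basis. (x \<bullet> b) *\<^sub>R (b - P b))"
      by (simp add: scaleR_diff_right sum_subtractf euclidean_representation
          linear_sum[OF P(1), symmetric] linear_scale[OF P(1), symmetric])
    then have "norm ((f ^^ N) (x - P x)) = norm (\<Sum>b\<in>Basis. (x \<bullet> b) *\<^sub>R (f ^^ N) (b - P b))"
      by (simp only: iter_sum iter_scale)
    also have "\<dots> \<le> (\<Sum>b\<in>Basis. \<bar>x \<bullet> b\<bar> * norm ((f ^^ N) (b - P b)))"
      by (rule order_trans[OF norm_sum]) simp
    also have "\<dots> \<le> (\<Sum>b\<in>Basis. norm x * norm ((f ^^ N) (b - P b)))"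
      by (intro sum_mono mult_right_mono) (auto simp: Basis_le_norm)
    also have "\<dots> \<le> norm x * (1/2)"
      using N(2) unfolding sum_distrib_left[symmetric] by (intro mult_left_mono) auto
    finally have "norm ((f ^^ N) (x - P x)) \<le> norm x / 2" by simp
    moreover have "norm ((f ^^ N) (P x)) \<le> M * (C * limit_norm x)"
      using bounded[of N "P x"] P(4)[of x] M_ge_1
      by (meson mult_left_mono order_trans zero_le_one)
    moreover have "norm ((f ^^ N) x) \<le> norm ((f ^^ N) (x - P x)) + norm ((f ^^ N) (P x))"
      using norm_triangle_ineq[of "(f ^^ N) (x - P x)" "(f ^^ N) (P x)"] by (simp add: iter_diff)
    ultimately show ?thesis by (simp add: mult.assoc)
  qed
  then show ?thesis using that[OF N(1), of "M * C"] M_ge_1 P(3) by simp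
qed

text \<open>Summing the norms of the first \<open>N\<close> iterates turns a contraction of the
  \<open>N\<close>th power into one of \<open>f\<close> itself: replacing \<open>x\<close> by
  \<open>f x\<close> drops the term |x| and adds the norm of the \<open>N\<close>th iterate, which
  is at most |x| / 2 up to the seminorm.\<close>

lemma adapted_norm_exists:
  obtains q :: "'a \<Rightarrow> real" and \<theta> C where
    "0 < \<theta>" "\<theta> < 1" "C \<ge> 0" "\<And>x. norm x \<le> q x" "\<And>x. q x \<le> C * norm x"
    "\<And>x y. q (x + y) \<le> q x + q y" "\<And>x. q (f x) \<le> \<theta> * q x + C * limit_norm x" "continuous_on UNIV q"
proof -
  obtain N C where N: "N \<ge> 1" "C \<ge> 0" "\<And>x. norm ((f ^^ N) x) \<le> norm x / 2 + C * limit_norm x"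
    by (rule contraction_modulo_limit_norm) blast
  define q where "q x = (\<Sum>i<N. norm ((f ^^ i) x))" for x
  \<comment> \<open>The loss |x| / 2 is at least the fraction 1 / (2 N M) of \<open>q x\<close>,
    because q x <= N M |x|.\<close>
  define \<theta> where "\<theta> = 1 - 1 / (2 * (N * M))"
  define D where "D = max C (N * M)"
  have NM: "N * M \<ge> 1" using N(1) M_ge_1 by (metis mult_mono' of_nat_1 of_nat_mono mult_1 zero_le_one)
  have upper: "q x \<le> (N * M) * norm x" for x
    using sum_mono[of "{..<N}" "\<lambda>i. norm ((f ^^ i) x)" "\<lambda>_. M * norm x"] bounded by (simp add: q_def)
  have "q (f x) \<le> \<theta> * q x + D * limit_norm x" for x
  proof -
    have "q (f x) = (\<Sum>i<N. norm ((f ^^ Suc i) x))"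
      by (simp add: q_def iter_step)
    then have "q (f x) + norm x = q x + norm ((f ^^ N) x)"
      using sum.lessThan_Suc_shift[of "\<lambda>i. norm ((f ^^ i) x)" N]
        sum.lessThan_Suc[of "\<lambda>i. norm ((f ^^ i) x)" N] by (simp add: q_def)
    moreover have "q x / (2 * (N * M)) \<le> norm x / 2"
      using upper[of x] NM by (simp add: field_simps)
    moreover have "C * limit_norm x \<le> D * limit_norm x"
      by (intro mult_right_mono) (auto simp: D_def limit_norm_nonneg)
    ultimately show ?thesis using N(3)[of x] by (simp add: \<theta>_def left_diff_distrib)
  qed
  moreover have "norm x \<le> q x" for x
  proof -
    have "norm ((f ^^ 0) x) \<le> q x"
      unfolding q_def using N(1) by (intro member_le_sum) auto
    then show ?thesis by simp
  qed
  moreover have "q x \<le> D * norm x" for x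
    using upper[of x] by (rule order_trans) (auto simp: D_def intro!: mult_right_mono)
  moreover have "q (x + y) \<le> q x + q y" for x y
    unfolding q_def sum.distrib[symmetric] by (intro sum_mono) (simp add: iter_add norm_triangle_ineq)
  moreover have "0 < \<theta>" "\<theta> < 1" using NM by (auto simp: \<theta>_def field_simps)
  moreover have "continuous_on UNIV q"
    unfolding q_def
    by (intro continuous_intros linear_continuous_on linear_conv_bounded_linear[THEN iffD1] linear_funpow linear)
  moreover have "D \<ge> 0" using N(2) by (simp add: D_def)
  ultimately show ?thesis using that[of \<theta> D q] by blast
qed

text \<open>A convergent subsequence of the orbit of \<open>x\<close> shows that \<open>f ^^ m\<close> nearly fixes \<open>x\<close> for
  arbitrarily large \<open>m\<close>, because \<open>f\<close> is isometric for \<open>limit_norm\<close>.\<close>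

lemma recurrence:
  assumes "e > 0"
  shows "\<exists>m\<ge>m0. limit_norm ((f ^^ m) x - x) < e"
proof -
  have "bounded (range (\<lambda>n. (f ^^ n) x))"
    using bounded by (intro boundedI[where B = "M * norm x"]) auto
  then obtain l r where r: "strict_mono r" "((\<lambda>n. (f ^^ n) x) \<circ> r) \<longlonglongrightarrow> l"
    using bounded_imp_convergent_subsequence by metis
  then have "Cauchy ((\<lambda>n. (f ^^ n) x) \<circ> r)"
    by (intro LIMSEQ_imp_Cauchy)
  moreover have "e / M > 0" using assms M_ge_1 by simp
  ultimately obtain k where k: "\<And>i j. i \<ge> k \<Longrightarrow> j \<ge> k \<Longrightarrow> dist ((f ^^ r i) x) ((f ^^ r j) x) < e / M"
    unfolding Cauchy_def by (metis comp_apply)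
  \<comment> \<open>As \<open>r j\<close> is at least \<open>j\<close>, this index lies at least
    \<open>m0\<close> iterates beyond \<open>r k\<close>. The first \<open>r k\<close> iterates
    common to both terms are then cancelled by isometry.\<close>
  define j where "j = r k + m0 + k"
  have "r j \<ge> j" using r(1) by (rule seq_suble)
  define m where "m = r j - r k"
  have m: "m \<ge> m0" "r j = r k + m"
    using \<open>r j \<ge> j\<close> by (auto simp: m_def j_def)
  have "limit_norm ((f ^^ m) x - x) = limit_norm ((f ^^ r j) x - (f ^^ r k) x)"
    using limit_norm_iter[of "r k" "(f ^^ m) x - x"] by (simp add: m(2) iter_diff funpow_add)
  also have "\<dots> \<le> M * norm ((f ^^ r j) x - (f ^^ r k) x)" by (rule limit_norm_le)
  also have "\<dots> < e"
    using k[of j k] M_ge_1 by (simp add: j_def dist_norm field_simps)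
  finally show ?thesis using m(1) by blast
qed

end

section \<open>Reachability modulo decaying states\<close>

locale controlled_map = power_bounded_map f M
  for f :: "'a::euclidean_space \<Rightarrow> 'a" and M :: real +
  fixes B :: "'b::euclidean_space \<Rightarrow> 'a" and K :: "'a \<Rightarrow> 'b"
  assumes linear_B: "linear B"
    and stabilized: "(\<lambda>n. ((\<lambda>x. f x + B (K x)) ^^ n) x) \<longlonglongrightarrow> 0"
begin

text \<open>The preimage of the \<open>j\<close>-step reachable subspace of the quotient by the null
  space.\<close>

definition reach :: "nat \<Rightarrow> 'a set" where
  "reach j = {s + (\<Sum>i<j. (f ^^ i) (B (u i))) | s u. limit_norm s = 0}"

lemma null_in_reach: "limit_norm s = 0 \<Longrightarrow> s \<in> reach j"
  unfolding reach_def using linear_0[OF linear_B]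
  by (intro CollectI exI[of _ s] exI[of _ "\<lambda>_. 0"]) (simp add: iter_0)

lemma subspace_reach: "subspace (reach j)"
proof (rule subspaceI)
  note S = subspace_limit_norm_null
  show "0 \<in> reach j" by (simp add: null_in_reach)
  fix x y and c :: real assume "x \<in> reach j"
  then obtain s u where x: "x = s + (\<Sum>i<j. (f ^^ i) (B (u i)))" "limit_norm s = 0"
    by (auto simp: reach_def)
  have "c *\<^sub>R x = c *\<^sub>R s + (\<Sum>i<j. (f ^^ i) (B (c *\<^sub>R u i)))"
    by (simp add: x linear_scale[OF linear_B] iter_scale scaleR_add_right scaleR_sum_right)
  moreover have "limit_norm (c *\<^sub>R s) = 0" using subspace_scale[OF S] x(2) by simp
  ultimately show "c *\<^sub>R x \<in> reach j" unfolding reach_def by (intro CollectI exI conjI)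
  assume "y \<in> reach j"
  then obtain t v where y: "y = t + (\<Sum>i<j. (f ^^ i) (B (v i)))" "limit_norm t = 0"
    by (auto simp: reach_def)
  have "x + y = (s + t) + (\<Sum>i<j. (f ^^ i) (B (u i + v i)))"
    by (simp add: x y linear_add[OF linear_B] iter_add sum.distrib algebra_simps)
  moreover have "limit_norm (s + t) = 0" using subspace_add[OF S] x(2) y(2) by simp
  ultimately show "x + y \<in> reach j" unfolding reach_def by (intro CollectI exI conjI)
qed

lemma reach_Suc: "reach j \<subseteq> reach (Suc j)"
proof
  fix x assume "x \<in> reach j"
  then obtain s u where x: "x = s + (\<Sum>i<j. (f ^^ i) (B (u i)))" "limit_norm s = 0"
    by (auto simp: reach_def)
  have "x = s + (\<Sum>i<Suc j. (f ^^ i) (B ((u(j := 0)) i)))"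
    by (simp add: x linear_0[OF linear_B] iter_0)
  then show "x \<in> reach (Suc j)" using x(2) unfolding reach_def by (intro CollectI exI conjI)
qed

lemma sum_shift:
  "(\<Sum>i<Suc j. (f ^^ i) (B (u i))) = B (u 0) + f (\<Sum>i<j. (f ^^ i) (B (u (Suc i))))"
  by (simp add: sum.lessThan_Suc_shift linear_sum[OF linear] del: sum.lessThan_Suc)

lemma step_in_reach:
  assumes "z \<in> reach j"
  shows "B v + f z \<in> reach (Suc j)"
proof -
  obtain s u where z: "z = s + (\<Sum>i<j. (f ^^ i) (B (u i)))" "limit_norm s = 0"
    using assms by (auto simp: reach_def)
  have "B v + f z = f s + (\<Sum>i<Suc j. (f ^^ i) (B (case_nat v u i)))"
    unfolding sum_shift by (simp add: z linear_add[OF linear])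
  moreover have "limit_norm (f s) = 0" using z by simp
  ultimately show ?thesis unfolding reach_def by (intro CollectI exI conjI)
qed

lemma reach_Suc_cases:
  assumes "z \<in> reach (Suc j)"
  obtains v y s where "y \<in> reach j" "limit_norm s = 0" "z = B v + f y + s"
proof -
  obtain s u where z: "z = s + (\<Sum>i<Suc j. (f ^^ i) (B (u i)))" "limit_norm s = 0"
    using assms by (auto simp: reach_def)
  have "(\<Sum>i<j. (f ^^ i) (B (u (Suc i)))) \<in> reach j"
    unfolding reach_def by (intro CollectI exI[of _ 0] exI[of _ "\<lambda>i. u (Suc i)"]) simp
  moreover have "z = B (u 0) + f (\<Sum>i<j. (f ^^ i) (B (u (Suc i)))) + s"
    unfolding z sum_shift by simp
  ultimately show ?thesis using that z(2) by blast
qed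

text \<open>Up to null vectors, \<open>reach (Suc j)\<close> consists of the sums of a value of
  \<open>B\<close> and an image of \<open>reach j\<close> under \<open>f\<close>, so one coincidence
  repeats forever.\<close>

lemma reach_stationary:
  assumes "reach (Suc j) = reach j"
  shows "reach (j + n) = reach j"
proof (induction n)
  case (Suc n)
  have "reach (Suc (j + n)) \<subseteq> reach j"
  proof
    fix z assume "z \<in> reach (Suc (j + n))"
    then obtain v y s where *: "y \<in> reach (j + n)" "limit_norm s = 0" "z = B v + f y + s"
      by (rule reach_Suc_cases)
    then have "B v + f y \<in> reach j" using Suc assms step_in_reach by blast
    then show "z \<in> reach j"
      unfolding * using null_in_reach[OF *(2)] by (rule subspace_add[OF subspace_reach])
  qed
  then show ?case using reach_Suc[of "j + n"] Suc by auto
qed simp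

text \<open>Otherwise the dimension would grow at each of the first \<open>DIM('a) + 1\<close> steps
  and exceed that of the space.\<close>

lemma reach_DIM_stationary: "reach (Suc DIM('a)) = reach DIM('a)"
proof -
  have "\<exists>j\<le>DIM('a). reach (Suc j) = reach j"
  proof (rule ccontr)
    assume "\<not> ?thesis"
    then have strict: "reach j \<subset> reach (Suc j)" if "j \<le> DIM('a)" for j
      using that reach_Suc by blast
    have "j \<le> Suc DIM('a) \<Longrightarrow> j \<le> dim (reach j)" for j
    proof (induction j)
      case (Suc j)
      have "dim (reach j) < dim (reach (Suc j))"
        using strict[of j] Suc.prems subspace_reach by (intro dim_psubset) (simp add: span_eq_iff[THEN iffD2])
      then show ?case using Suc by simp
    qed simp
    from this[of "Suc DIM('a)"] show False
      using dim_subset_UNIV[of "reach (Suc DIM('a))"] by simp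
  qed
  then obtain j where j: "j \<le> DIM('a)" "reach (Suc j) = reach j" by blast
  show ?thesis
    using reach_stationary[OF j(2), of "DIM('a) - j"] reach_stationary[OF j(2), of "Suc DIM('a) - j"] j(1)
    by simp
qed

text \<open>The free orbit and the stabilized orbit of \<open>x\<close> differ by a reachable
  vector. Along recurrence times the free orbit returns to \<open>x\<close> in the seminorm while
  the stabilized one tends to 0, so \<open>x\<close> is, modulo null vectors, a limit of reachable
  vectors. The reachable subspace is closed and contains the null vectors.\<close>

lemma reach_eq_UNIV: "reach DIM('a) = UNIV"
proof -
  define Y where "Y = reach DIM('a)"
  have Y: "subspace Y" unfolding Y_def by (rule subspace_reach)
  have step: "B v + f y \<in> Y" if "y \<in> Y" for v y
    using step_in_reach[of y "DIM('a)" v] that reach_DIM_stationary by (simp add: Y_def)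
  define G where "G x = f x + B (K x)" for x
  have G: "(\<lambda>n. (G ^^ n) x) \<longlonglongrightarrow> 0" for x
    using stabilized[of x] by (simp add: G_def[abs_def])
  have diff: "(f ^^ n) x - (G ^^ n) x \<in> Y" for n x
  proof (induction n)
    case 0
    show ?case using subspace_0[OF Y] by simp
  next
    case (Suc n)
    \<comment> \<open>The difference of the orbits is itself a trajectory, driven by minus the
      stabilizing feedback.\<close>
    have "(f ^^ Suc n) x - (G ^^ Suc n) x
        = B (- K ((G ^^ n) x)) + f ((f ^^ n) x - (G ^^ n) x)"
      by (simp add: G_def linear_diff[OF linear] linear_neg[OF linear_B])
    then show ?case using step[OF Suc] by simp
  qed
  obtain P C where P: "linear P" "\<And>x. limit_norm (x - P x) = 0" "C \<ge> 0" "\<And>x. norm (P x) \<le> C * limit_norm x"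
    by (rule projection_exists) blast
  \<comment> \<open>\<open>P\<close> turns convergence in the seminorm into convergence in norm, and
    it does not leave \<open>Y\<close> because it changes vectors by null vectors only.\<close>
  have PY: "P y \<in> Y" if "y \<in> Y" for y
    using subspace_diff[OF Y that null_in_reach[OF P(2), of y "DIM('a)", folded Y_def]] by simp
  have "x \<in> Y" for x
  proof -
    have "\<exists>m\<ge>k. limit_norm ((f ^^ m) x - x) < 1 / Suc k" for k
      by (rule recurrence) simp
    then obtain m where m: "\<And>k. m k \<ge> k" "\<And>k. limit_norm ((f ^^ m k) x - x) < 1 / Suc k"
      by metis
    define y where "y k = (f ^^ m k) x - (G ^^ m k) x" for k
    have "filterlim m at_top sequentially"
      using m(1) by (intro filterlim_at_top_mono[OF filterlim_ident]) auto
    then have Gm: "(\<lambda>k. (G ^^ m k) x) \<longlonglongrightarrow> 0"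
      by (rule filterlim_compose[OF G])
    have bound: "norm (P (y k) - P x) \<le> C * (1 / Suc k + M * norm ((G ^^ m k) x))" for k
    proof -
      have "y k - x = ((f ^^ m k) x - x) - (G ^^ m k) x" by (simp add: y_def)
      then have "limit_norm (y k - x) \<le> limit_norm ((f ^^ m k) x - x) + limit_norm ((G ^^ m k) x)"
        by (metis limit_norm_diff)
      also have "\<dots> \<le> 1 / Suc k + M * norm ((G ^^ m k) x)"
        using m(2)[of k] limit_norm_le by (intro add_mono) auto
      finally have "C * limit_norm (y k - x) \<le> C * (1 / Suc k + M * norm ((G ^^ m k) x))"
        using P(3) by (rule mult_left_mono)
      then show ?thesis using P(4)[of "y k - x"] by (simp add: linear_diff[OF P(1)])
    qed
    have "(\<lambda>k. C * (1 / Suc k + M * norm ((G ^^ m k) x))) \<longlonglongrightarrow> C * (0 + M * norm (0::'a))"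
      by (intro tendsto_intros Gm lim_1_over_n[THEN LIMSEQ_Suc])
    then have "(\<lambda>k. C * (1 / Suc k + M * norm ((G ^^ m k) x))) \<longlonglongrightarrow> 0" by simp
    then have "(\<lambda>k. P (y k) - P x) \<longlonglongrightarrow> 0"
      by (rule Lim_null_comparison[rotated]) (use bound in auto)
    then have "(\<lambda>k. P (y k)) \<longlonglongrightarrow> P x"
      by (simp add: LIM_zero_iff)
    moreover have "P (y k) \<in> Y" for k
      using PY diff by (simp add: y_def)
    ultimately have "P x \<in> Y"
      using closed_sequentially[OF closed_subspace[OF Y], of "\<lambda>k. P (y k)" "P x"] by blast
    then show ?thesis
      using subspace_add[OF Y _ null_in_reach[OF P(2), of x "DIM('a)", folded Y_def]] by force
  qed
  then show ?thesis by (auto simp: Y_def)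
qed

text \<open>Controls are chosen for basis vectors and extended linearly; applying \<open>P\<close>
  first costs only a null vector and bounds the controls by the seminorm instead of the
  norm.\<close>

lemma steering_exists:
  obtains F :: "nat \<Rightarrow> 'a \<Rightarrow> 'b" and C where
    "\<And>i. linear (F i)" "C \<ge> 0" "\<And>i x. i < DIM('a) \<Longrightarrow> norm (F i x) \<le> C * limit_norm x"
    "\<And>x. limit_norm (x - (\<Sum>i<DIM('a). (f ^^ i) (B (F i x)))) = 0"
proof -
  have "\<exists>s u. limit_norm s = 0 \<and> b = s + (\<Sum>i<DIM('a). (f ^^ i) (B (u i)))" for b
    using reach_eq_UNIV unfolding reach_def by blast
  then obtain s u where su: "\<And>b. limit_norm (s b) = 0"
      "\<And>b. b = s b + (\<Sum>i<DIM('a). (f ^^ i) (B (u b i)))" by metis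
  obtain P C where P: "linear P" "\<And>x. limit_norm (x - P x) = 0" "C \<ge> 0" "\<And>x. norm (P x) \<le> C * limit_norm x"
    by (rule projection_exists) blast
  define F where "F i x = (\<Sum>b\<in>Basis. (P x \<bullet> b) *\<^sub>R u b i)" for i x
  have lin: "linear (F i)" for i
    unfolding F_def
    by (intro linearI) (simp_all add: linear_add[OF P(1)] linear_scale[OF P(1)] inner_add_left
        scaleR_add_left sum.distrib scaleR_sum_right)
  define D where "D = (\<Sum>i<DIM('a). \<Sum>b\<in>Basis. norm (u b i)) * C"
  have bound: "norm (F i x) \<le> D * limit_norm x" if "i < DIM('a)" for i x
  proof -
    have "norm (F i x) \<le> (\<Sum>b\<in>Basis. \<bar>P x \<bullet> b\<bar> * norm (u b i))"
      unfolding F_def by (rule order_trans[OF norm_sum]) simp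
    also have "\<dots> \<le> (\<Sum>b\<in>Basis. norm (P x) * norm (u b i))"
      by (intro sum_mono mult_right_mono) (auto simp: Basis_le_norm)
    also have "\<dots> = (\<Sum>b\<in>Basis. norm (u b i)) * norm (P x)"
      by (simp add: sum_distrib_left mult.commute)
    also have "\<dots> \<le> (\<Sum>i<DIM('a). \<Sum>b\<in>Basis. norm (u b i)) * (C * limit_norm x)"
      using that P(4)
      by (intro mult_mono member_le_sum[of i "{..<DIM('a)}" "\<lambda>i. \<Sum>b\<in>Basis. norm (u b i)"])
         (auto intro!: sum_nonneg)
    finally show ?thesis by (simp add: D_def mult.assoc)
  qed
  have null: "limit_norm (x - (\<Sum>i<DIM('a). (f ^^ i) (B (F i x)))) = 0" for x
  proof -
    have "(\<Sum>i<DIM('a). (f ^^ i) (B (F i x)))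
        = (\<Sum>i<DIM('a). \<Sum>b\<in>Basis. (P x \<bullet> b) *\<^sub>R (f ^^ i) (B (u b i)))"
      by (simp add: F_def linear_sum[OF linear_B] linear_scale[OF linear_B] iter_sum iter_scale)
    also have "\<dots> = (\<Sum>b\<in>Basis. (P x \<bullet> b) *\<^sub>R (\<Sum>i<DIM('a). (f ^^ i) (B (u b i))))"
      by (subst sum.swap) (simp add: scaleR_sum_right)
    also have "\<dots> = (\<Sum>b\<in>Basis. (P x \<bullet> b) *\<^sub>R (b - s b))"
      using su(2) by (metis (no_types, lifting) add_diff_cancel_left')
    also have "\<dots> = P x - (\<Sum>b\<in>Basis. (P x \<bullet> b) *\<^sub>R s b)"
      by (simp add: scaleR_diff_right sum_subtractf euclidean_representation)
    finally have eq: "x - (\<Sum>i<DIM('a). (f ^^ i) (B (F i x)))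
        = (x - P x) + (\<Sum>b\<in>Basis. (P x \<bullet> b) *\<^sub>R s b)" by simp
    have "x - (\<Sum>i<DIM('a). (f ^^ i) (B (F i x))) \<in> {x. limit_norm x = 0}"
      unfolding eq using subspace_limit_norm_null P(2) su(1)
      by (intro subspace_add subspace_sum subspace_scale) auto
    then show ?thesis by simp
  qed
  have "D \<ge> 0" unfolding D_def using P(3) by (auto intro!: mult_nonneg_nonneg sum_nonneg)
  with lin bound null show ?thesis using that[of F D] by blast
qed

text \<open>The saturation factor is \<open>r / max r (limit_norm y)\<close>, so that one block of \<open>DIM('a)\<close> steps
  shortens \<open>limit_norm y\<close> by \<open>r\<close>, or kills it if it is below \<open>r\<close>.\<close>

lemma saturated_controls_exist:
  obtains \<phi> :: "real \<Rightarrow> nat \<Rightarrow> 'a \<Rightarrow> 'b" and C where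
    "C \<ge> 0" "\<And>r i. r > 0 \<Longrightarrow> continuous_on UNIV (\<phi> r i)"
    "\<And>r i y. r > 0 \<Longrightarrow> i < DIM('a) \<Longrightarrow> norm (\<phi> r i y) \<le> C * r"
    "\<And>r i y. r > 0 \<Longrightarrow> i < DIM('a) \<Longrightarrow> norm (\<phi> r i y) \<le> C * limit_norm y"
    "\<And>r y. r > 0 \<Longrightarrow> limit_norm ((f ^^ DIM('a)) y
        + (\<Sum>i<DIM('a). (f ^^ (DIM('a) - Suc i)) (B (\<phi> r i y)))) \<le> max (limit_norm y - r) 0"
proof -
  obtain F C where F: "\<And>i. linear (F i)" "C \<ge> 0" "\<And>i x. i < DIM('a) \<Longrightarrow> norm (F i x) \<le> C * limit_norm x"
    "\<And>x. limit_norm (x - (\<Sum>i<DIM('a). (f ^^ i) (B (F i x)))) = 0"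
    by (rule steering_exists) blast
  define \<sigma> where "\<sigma> r y = r / max r (limit_norm y)" for r y
  \<comment> \<open>The target to be cancelled is the uncontrolled state at the end of the block,
    hence the iterate of \<open>y\<close> and the sign. The index is reversed since control
    \<open>i\<close> is still carried on by \<open>DIM('a) - Suc i\<close> iterates of
    \<open>f\<close>.\<close>
  define \<phi> where "\<phi> r i y = - (\<sigma> r y *\<^sub>R F (DIM('a) - Suc i) ((f ^^ DIM('a)) y))" for r i y
  have \<sigma>: "0 \<le> \<sigma> r y" "\<sigma> r y \<le> 1" "\<sigma> r y * limit_norm y \<le> r"
      "(1 - \<sigma> r y) * limit_norm y = max (limit_norm y - r) 0" if "r > 0" for r y
    using that limit_norm_nonneg[of y] by (auto simp: \<sigma>_def max_def field_simps)
  have cont: "continuous_on UNIV (\<phi> r i)" if "r > 0" for r i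
    unfolding \<phi>_def \<sigma>_def
    using that linear_compose[OF linear_funpow[OF linear] F(1)]
    by (intro continuous_intros continuous_on_limit_norm linear_continuous_on
        linear_conv_bounded_linear[THEN iffD1]) (auto simp: o_def)
  have norm_\<phi>: "norm (\<phi> r i y) \<le> \<sigma> r y * (C * limit_norm y)" if "r > 0" "i < DIM('a)" for r i y
    using F(3)[of "DIM('a) - Suc i" "(f ^^ DIM('a)) y"] \<sigma>(1)[OF that(1)] that
    by (auto simp: \<phi>_def intro!: mult_left_mono)
  have b1: "norm (\<phi> r i y) \<le> C * r" if "r > 0" "i < DIM('a)" for r i y
    using norm_\<phi>[OF that, of y] mult_left_mono[OF \<sigma>(3)[OF that(1), of y] F(2)]
    by (simp add: mult_ac)
  have b2: "norm (\<phi> r i y) \<le> C * limit_norm y" if "r > 0" "i < DIM('a)" for r i y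
    using norm_\<phi>[OF that, of y] mult_right_mono[OF \<sigma>(2)[OF that(1), of y], of "C * limit_norm y"] F(2)
      limit_norm_nonneg[of y]
    by simp
  have b3: "limit_norm ((f ^^ DIM('a)) y + (\<Sum>i<DIM('a). (f ^^ (DIM('a) - Suc i)) (B (\<phi> r i y))))
      \<le> max (limit_norm y - r) 0" if "r > 0" for r y
  proof -
    define z where "z = (f ^^ DIM('a)) y"
    define s where "s = z - (\<Sum>i<DIM('a). (f ^^ i) (B (F i z)))"
    have "(\<Sum>i<DIM('a). (f ^^ (DIM('a) - Suc i)) (B (\<phi> r i y)))
        = - (\<sigma> r y *\<^sub>R (\<Sum>i<DIM('a). (f ^^ (DIM('a) - Suc i)) (B (F (DIM('a) - Suc i) z))))"
      by (simp add: \<phi>_def z_def linear_neg[OF linear_B] linear_scale[OF linear_B] iter_scale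
          linear_neg[OF linear_funpow[OF linear]] scaleR_sum_right sum_negf)
    also have "(\<Sum>i<DIM('a). (f ^^ (DIM('a) - Suc i)) (B (F (DIM('a) - Suc i) z))) = z - s"
      unfolding s_def by (simp add: sum.nat_diff_reindex[of "\<lambda>i. (f ^^ i) (B (F i z))"])
    \<comment> \<open>A convex combination of the uncontrolled endpoint and the null steering error
      \<open>s\<close>; only the first counts in the seminorm.\<close>
    finally have "(f ^^ DIM('a)) y + (\<Sum>i<DIM('a). (f ^^ (DIM('a) - Suc i)) (B (\<phi> r i y)))
        = (1 - \<sigma> r y) *\<^sub>R z + \<sigma> r y *\<^sub>R s"
      by (simp add: z_def[symmetric] algebra_simps)
    also have "limit_norm \<dots> \<le> \<bar>1 - \<sigma> r y\<bar> * limit_norm z + \<bar>\<sigma> r y\<bar> * limit_norm s"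
      by (rule order_trans[OF limit_norm_triangle add_mono[OF limit_norm_scale limit_norm_scale]])
    also have "\<dots> = (1 - \<sigma> r y) * limit_norm y"
      using \<sigma>(2)[OF that, of y] F(4)[of z] by (simp add: s_def z_def)
    finally show ?thesis using \<sigma>(4)[OF that] by simp
  qed
  show ?thesis using that[OF F(2) cont b1 b2 b3] .
qed

end

section \<open>Second moments of the Lindley recursion\<close>

lemma sum_inverse_squares_le: "(\<Sum>j<n. 1 / (real (Suc j))\<^sup>2) \<le> 2"
proof -
  \<comment> \<open>For \<open>n = 0\<close> the convention 1 / 0 = 0 makes this true, but the
    telescoping step from 0 to 1 is treated apart.\<close>
  have "(\<Sum>j<n. 1 / (real (Suc j))\<^sup>2) \<le> 2 - 1 / n"
  proof (induction n)
    case (Suc n)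
    have "1 / (real (Suc n))\<^sup>2 \<le> 1 / n - 1 / Suc n" if "n > 0"
    proof -
      have "1 / (real (Suc n))\<^sup>2 \<le> 1 / (real n * real (Suc n))"
        using that by (intro divide_left_mono) (auto simp: power2_eq_square)
      also have "\<dots> = 1 / n - 1 / Suc n" using that by (simp add: field_simps)
      finally show ?thesis .
    qed
    then show ?case using Suc by (cases "n = 0") auto
  qed simp
  then show ?thesis by (rule order_trans) simp
qed

text \<open>In expectation the linear term will be nonpositive, so only the error divided by
  \<open>a\<^sup>2\<close> matters. If v >= 2a, the square of x - \<rho> is charged to v / a >= 1.
  If v < 2a, a positive left side is at most x^2 and forces \<open>v\<close> or \<open>x\<close> to
  be at least \<open>a\<close>.\<close>

lemma lindley_pointwise:
  fixes v x a \<rho> :: real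
  assumes "0 \<le> v" "0 \<le> x" "0 \<le> \<rho>" "0 < a"
  shows "(max 0 (v - 2 * a + x - \<rho>))\<^sup>2
    \<le> (max 0 (v - 2 * a))\<^sup>2 + 2 * (max 0 (v - 2 * a) * (x - \<rho>))
      + (v\<^sup>2 * (x\<^sup>2 + \<rho>\<^sup>2) + x ^ 4) / a\<^sup>2"
proof -
  define z where "z = v - 2 * a"
  have frac: "(v\<^sup>2 * (x\<^sup>2 + \<rho>\<^sup>2) + x ^ 4) / a\<^sup>2 = (v / a)\<^sup>2 * (x\<^sup>2 + \<rho>\<^sup>2) + (x / a)\<^sup>2 * x\<^sup>2"
    by (simp add: add_divide_distrib power_divide flip: power_add)
  have sq_ge: "y \<le> (v / a)\<^sup>2 * y" if "a \<le> v" "0 \<le> y" for y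
    using that assms mult_right_mono[of 1 "(v / a)\<^sup>2" y] by (simp add: one_le_power)
  show ?thesis
  proof (cases "0 \<le> z")
    case True
    have "(max 0 (z + x - \<rho>))\<^sup>2 \<le> (z + x - \<rho>)\<^sup>2"
      by (simp add: max_def)
    also have "\<dots> = z\<^sup>2 + 2 * (z * (x - \<rho>)) + (x - \<rho>)\<^sup>2"
      by (simp add: power2_eq_square algebra_simps)
    also have "(x - \<rho>)\<^sup>2 \<le> x\<^sup>2 + \<rho>\<^sup>2"
      using assms by (simp add: power2_diff)
    also have "x\<^sup>2 + \<rho>\<^sup>2 \<le> (v / a)\<^sup>2 * (x\<^sup>2 + \<rho>\<^sup>2)"
      using True assms by (intro sq_ge) (auto simp: z_def)
    also have "\<dots> \<le> (v / a)\<^sup>2 * (x\<^sup>2 + \<rho>\<^sup>2) + (x / a)\<^sup>2 * x\<^sup>2"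
      by simp
    finally show ?thesis
      using True by (simp add: frac z_def[symmetric])
  next
    case False
    have "(max 0 (z + x - \<rho>))\<^sup>2 \<le> (v / a)\<^sup>2 * (x\<^sup>2 + \<rho>\<^sup>2) + (x / a)\<^sup>2 * x\<^sup>2"
    proof (cases "z + x - \<rho> \<le> 0")
      case True
      then show ?thesis by (simp add: max_def)
    next
      case pos: False
      then have "(max 0 (z + x - \<rho>))\<^sup>2 \<le> x\<^sup>2"
        using False assms by (intro power_mono) auto
      also have "\<dots> \<le> (v / a)\<^sup>2 * (x\<^sup>2 + \<rho>\<^sup>2) + (x / a)\<^sup>2 * x\<^sup>2"
      proof (cases "a \<le> v")
        case True
        have "x\<^sup>2 \<le> (v / a)\<^sup>2 * x\<^sup>2" by (intro sq_ge True) simp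
        also have "\<dots> \<le> (v / a)\<^sup>2 * (x\<^sup>2 + \<rho>\<^sup>2)" by (intro mult_left_mono) auto
        finally show ?thesis by (simp add: add_increasing2)
      next
        case False
        then have "a \<le> x" using pos assms by (simp add: z_def)
        then have "1 \<le> (x / a)\<^sup>2" using assms by (simp add: one_le_power)
        then have "x\<^sup>2 \<le> (x / a)\<^sup>2 * x\<^sup>2" using mult_right_mono[of 1 "(x / a)\<^sup>2" "x\<^sup>2"] by simp
        then show ?thesis by (simp add: add_increasing)
      qed
      finally show ?thesis .
    qed
    then show ?thesis using False by (simp add: frac z_def[symmetric] max_def)
  qed
qed

lemma integrable_of_nonneg_le:
  fixes g h :: "'a \<Rightarrow> real"
  assumes "integrable M h" "g \<in> borel_measurable M" "\<And>\<omega>. 0 \<le> g \<omega>" "\<And>\<omega>. g \<omega> \<le> h \<omega>"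
  shows "integrable M g"
proof (rule Bochner_Integration.integrable_bound[OF assms(1,2)], rule AE_I2)
  fix \<omega> show "norm (g \<omega>) \<le> norm (h \<omega>)"
    using assms(3)[of \<omega>] assms(4)[of \<omega>] by simp
qed

lemma le_one_plus_power4: "x \<le> 1 + x ^ 4" "x\<^sup>2 \<le> 1 + x ^ 4" if "0 \<le> x" for x :: real
proof -
  have "0 \<le> (x\<^sup>2 - 1/2)\<^sup>2" "0 \<le> (x - 1/2)\<^sup>2" by auto
  then show "x \<le> 1 + x ^ 4" "x\<^sup>2 \<le> 1 + x ^ 4"
    by (simp_all add: power2_eq_square power4_eq_xxxx algebra_simps)
qed

context prob_space
begin

lemma integrable_power_of_power4:
  fixes X :: "'a \<Rightarrow> real"
  assumes [measurable]: "X \<in> borel_measurable M" and int: "integrable M (\<lambda>\<omega>. X \<omega> ^ 4)"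
    and nonneg: "\<And>\<omega>. 0 \<le> X \<omega>"
  shows "integrable M X" "integrable M (\<lambda>\<omega>. (X \<omega>)\<^sup>2)"
proof -
  have int1: "integrable M (\<lambda>\<omega>. 1 + X \<omega> ^ 4)" using int by simp
  show "integrable M X" "integrable M (\<lambda>\<omega>. (X \<omega>)\<^sup>2)"
    using le_one_plus_power4 nonneg by (auto intro!: integrable_of_nonneg_le[OF int1])
qed

text \<open>Looking back from time \<open>N\<close>, the shifted moments \<open>E ((V n - c (N - n))\<^sup>+)\<^sup>2\<close> increase by a summable
  amount per step: the drift of size \<open>c\<close> is absorbed by the shift, and only the rare event that
  \<open>V n\<close> or the increment has size of order \<open>c (N - n)\<close> contributes.\<close>

lemma lindley_second_moment:
  fixes V \<xi> :: "nat \<Rightarrow> 'a \<Rightarrow> real"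
  assumes V_meas [measurable]: "\<And>n. V n \<in> borel_measurable M"
    and \<xi>_meas [measurable]: "\<And>n. \<xi> n \<in> borel_measurable M"
    and V_nonneg: "\<And>n \<omega>. 0 \<le> V n \<omega>" and \<xi>_nonneg: "\<And>n \<omega>. 0 \<le> \<xi> n \<omega>"
    and V_0: "\<And>\<omega>. V 0 \<omega> = v0"
    and V_Suc: "\<And>n \<omega>. V (Suc n) \<omega> \<le> max 0 (V n \<omega> + \<xi> n \<omega> - (\<rho> + c))"
    and indep: "\<And>n. indep_var borel (V n) borel (\<xi> n)"
    and int4: "\<And>n. integrable M (\<lambda>\<omega>. \<xi> n \<omega> ^ 4)"
    and mean: "\<And>n. expectation (\<xi> n) \<le> \<rho>"
    and D2: "\<And>n. expectation (\<lambda>\<omega>. (\<xi> n \<omega>)\<^sup>2 + \<rho>\<^sup>2) \<le> D"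
    and D4: "\<And>n. expectation (\<lambda>\<omega>. \<xi> n \<omega> ^ 4) \<le> D"
    and c: "0 < c" "16 * D \<le> c\<^sup>2"
  shows "integrable M (\<lambda>\<omega>. (V n \<omega>)\<^sup>2)" "expectation (\<lambda>\<omega>. (V n \<omega>)\<^sup>2) \<le> 2 * v0\<^sup>2 + 1"
proof -
  note \<xi>_int = integrable_power_of_power4[OF \<xi>_meas int4 \<xi>_nonneg]
  have "0 \<le> expectation (\<xi> 0)" by (intro Bochner_Integration.integral_nonneg) (simp add: \<xi>_nonneg)
  then have \<rho>: "0 \<le> \<rho>" using mean[of 0] by linarith
  have "0 \<le> expectation (\<lambda>\<omega>. \<xi> 0 \<omega> ^ 4)" by (intro Bochner_Integration.integral_nonneg) (simp add: \<xi>_nonneg)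
  then have D: "0 \<le> D" using D4[of 0] by linarith
  \<comment> \<open>Integrability, with no uniform bound, comes first so that all expectations below
    are meaningful.\<close>
  have V_int: "integrable M (\<lambda>\<omega>. (V n \<omega>)\<^sup>2)" for n
  proof (induction n)
    case 0
    show ?case by (simp add: V_0)
  next
    case (Suc n)
    have "(V (Suc n) \<omega>)\<^sup>2 \<le> 2 * (V n \<omega>)\<^sup>2 + 2 * (\<xi> n \<omega>)\<^sup>2" for \<omega>
    proof -
      have "V (Suc n) \<omega> \<le> V n \<omega> + \<xi> n \<omega>"
        using V_Suc[of n \<omega>] V_nonneg[of n \<omega>] \<xi>_nonneg[of n \<omega>] \<rho> c(1) by linarith
      then have "(V (Suc n) \<omega>)\<^sup>2 \<le> (V n \<omega> + \<xi> n \<omega>)\<^sup>2"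
        using V_nonneg by (intro power_mono) auto
      also have "\<dots> \<le> 2 * (V n \<omega>)\<^sup>2 + 2 * (\<xi> n \<omega>)\<^sup>2"
        using sum_squares_bound[of "V n \<omega>" "\<xi> n \<omega>"] by (simp add: power2_sum)
      finally show ?thesis .
    qed
    note le = this
    have int: "integrable M (\<lambda>\<omega>. 2 * (V n \<omega>)\<^sup>2 + 2 * (\<xi> n \<omega>)\<^sup>2)"
      using Suc \<xi>_int(2) by simp
    show ?case
      by (rule integrable_of_nonneg_le[OF int]) (use le in simp_all)
  qed
  then show "integrable M (\<lambda>\<omega>. (V n \<omega>)\<^sup>2)" .
  \<comment> \<open>The fixed point of K = v0^2 + (1 + K) / 2, the estimate with which the induction
    closes.\<close>
  define K where "K = 2 * v0\<^sup>2 + 1"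
  define h where "h n j = expectation (\<lambda>\<omega>. (max 0 (V n \<omega> - c * real j))\<^sup>2)" for n j
  have shift_le: "(max 0 (V n \<omega> - c * real j))\<^sup>2 \<le> (V n \<omega>)\<^sup>2" for n j \<omega>
    using V_nonneg[of n \<omega>] c(1) by (intro power_mono) auto
  have shift_int: "integrable M (\<lambda>\<omega>. (max 0 (V n \<omega> - c * real j))\<^sup>2)" for n j
    by (rule integrable_of_nonneg_le[OF V_int[of n]]) (use shift_le in simp_all)
  have step: "h (Suc n) j \<le> h n (Suc j) + (4 * D * (1 + K) / c\<^sup>2) * (1 / (real (Suc j))\<^sup>2)"
    if K: "expectation (\<lambda>\<omega>. (V n \<omega>)\<^sup>2) \<le> K" for n j
  proof -
    \<comment> \<open>Chosen so that \<open>2 * a\<close> is the shift for \<open>Suc j\<close>: the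
      drift \<open>c\<close> of one step raises the shift from \<open>j\<close> to
      \<open>Suc j\<close>.\<close>
    define a where "a = c * real (Suc j) / 2"
    have a: "a > 0" using c(1) by (simp add: a_def)
    define z where "z \<omega> = max 0 (V n \<omega> - 2 * a)" for \<omega>
    have z_eq: "z \<omega> = max 0 (V n \<omega> - c * real (Suc j))" for \<omega>
      by (simp add: z_def a_def)
    have h_z: "h n (Suc j) = expectation (\<lambda>\<omega>. (z \<omega>)\<^sup>2)"
      unfolding h_def z_eq ..
    have [measurable]: "z \<in> borel_measurable M" unfolding z_def by measurable
    have z_int2: "integrable M (\<lambda>\<omega>. (z \<omega>)\<^sup>2)" unfolding z_eq by (rule shift_int)
    have z_int: "integrable M z"
      by (rule square_integrable_imp_integrable[OF _ z_int2]) simp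
    have ind1: "indep_var borel z borel (\<lambda>\<omega>. \<xi> n \<omega> - \<rho>)"
      using indep_var_compose[OF indep[of n], of "\<lambda>v. max 0 (v - 2 * a)" borel "\<lambda>x. x - \<rho>" borel]
      by (simp add: o_def z_def[abs_def])
    have ind2: "indep_var borel (\<lambda>\<omega>. (V n \<omega>)\<^sup>2) borel (\<lambda>\<omega>. (\<xi> n \<omega>)\<^sup>2 + \<rho>\<^sup>2)"
      using indep_var_compose[OF indep[of n], of "\<lambda>v. v\<^sup>2" borel "\<lambda>x. x\<^sup>2 + \<rho>\<^sup>2" borel]
      by (simp add: o_def)
    have int\<xi>1: "integrable M (\<lambda>\<omega>. \<xi> n \<omega> - \<rho>)" and int\<xi>2: "integrable M (\<lambda>\<omega>. (\<xi> n \<omega>)\<^sup>2 + \<rho>\<^sup>2)"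
      using \<xi>_int[of n] by auto
    note i1 = indep_var_integrable[OF ind1 z_int int\<xi>1]
    note i2 = indep_var_integrable[OF ind2 V_int int\<xi>2]
    have "(max 0 (V (Suc n) \<omega> - c * real j))\<^sup>2 \<le> (z \<omega>)\<^sup>2 + 2 * (z \<omega> * (\<xi> n \<omega> - \<rho>))
        + ((V n \<omega>)\<^sup>2 * ((\<xi> n \<omega>)\<^sup>2 + \<rho>\<^sup>2) + \<xi> n \<omega> ^ 4) / a\<^sup>2" for \<omega>
    proof -
      have "0 \<le> c * real j" "2 * a = c * real j + c"
        using c(1) by (simp_all add: a_def algebra_simps)
      then have "max 0 (V (Suc n) \<omega> - c * real j) \<le> max 0 (V n \<omega> - 2 * a + \<xi> n \<omega> - \<rho>)"
        using V_Suc[of n \<omega>] by linarith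
      then have "(max 0 (V (Suc n) \<omega> - c * real j))\<^sup>2 \<le> (max 0 (V n \<omega> - 2 * a + \<xi> n \<omega> - \<rho>))\<^sup>2"
        by (intro power_mono) auto
      also note lindley_pointwise[OF V_nonneg \<xi>_nonneg \<rho> a]
      finally show ?thesis by (simp add: z_def)
    qed
    then have "h (Suc n) j \<le> expectation (\<lambda>\<omega>. (z \<omega>)\<^sup>2 + 2 * (z \<omega> * (\<xi> n \<omega> - \<rho>))
        + ((V n \<omega>)\<^sup>2 * ((\<xi> n \<omega>)\<^sup>2 + \<rho>\<^sup>2) + \<xi> n \<omega> ^ 4) / a\<^sup>2)"
      unfolding h_def using shift_int z_int2 i1 i2 int4
      by (intro Bochner_Integration.integral_mono) auto
    also have "\<dots> = h n (Suc j) + 2 * (expectation z * (expectation (\<xi> n) - \<rho>))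
        + (expectation (\<lambda>\<omega>. (V n \<omega>)\<^sup>2) * expectation (\<lambda>\<omega>. (\<xi> n \<omega>)\<^sup>2 + \<rho>\<^sup>2)
          + expectation (\<lambda>\<omega>. \<xi> n \<omega> ^ 4)) / a\<^sup>2"
      using z_int2 i1 i2 int4 \<xi>_int[of n] indep_var_lebesgue_integral[OF ind1 z_int int\<xi>1]
        indep_var_lebesgue_integral[OF ind2 V_int int\<xi>2]
      by (simp add: h_z prob_space)
    also have "\<dots> \<le> h n (Suc j) + 0 + (K * D + D) / a\<^sup>2"
    proof (intro add_mono divide_right_mono mult_mono K D2 D4)
      \<comment> \<open>Independence has factored the cross term; its second factor is nonpositive
        because \<rho> dominates the mean.\<close>
      have "0 \<le> expectation z" by (intro Bochner_Integration.integral_nonneg) (simp add: z_def)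
      then show "2 * (expectation z * (expectation (\<xi> n) - \<rho>)) \<le> 0"
        using mean[of n] by (simp add: mult_nonneg_nonpos)
      show "0 \<le> K" by (simp add: K_def)
    qed (auto intro!: Bochner_Integration.integral_nonneg)
    also have "(K * D + D) / a\<^sup>2 = (4 * D * (1 + K) / c\<^sup>2) * (1 / (real (Suc j))\<^sup>2)"
      unfolding a_def power_divide power_mult_distrib by (simp add: field_simps)
    finally show ?thesis by simp
  qed
  show "expectation (\<lambda>\<omega>. (V n \<omega>)\<^sup>2) \<le> 2 * v0\<^sup>2 + 1"
  proof (induction n rule: less_induct)
    case (less N)
    \<comment> \<open>Going back \<open>i\<close> steps from \<open>N\<close> costs the first
      \<open>i\<close> terms of a convergent series. Each step uses the bound \<open>K\<close> at an
      earlier time, hence the strong induction.\<close>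
    have "i \<le> N \<Longrightarrow> h N 0 \<le> h (N - i) i + (4 * D * (1 + K) / c\<^sup>2) * (\<Sum>j<i. 1 / (real (Suc j))\<^sup>2)" for i
    proof (induction i)
      case (Suc i)
      then have "h (N - i) i \<le> h (N - Suc i) (Suc i) + (4 * D * (1 + K) / c\<^sup>2) * (1 / (real (Suc i))\<^sup>2)"
        using step[of "N - Suc i" i] less[of "N - Suc i"] by (simp add: K_def Suc_diff_Suc)
      then show ?case using Suc by (simp add: distrib_left)
    qed simp
    from this[of N] have "h N 0 \<le> h 0 N + (4 * D * (1 + K) / c\<^sup>2) * (\<Sum>j<N. 1 / (real (Suc j))\<^sup>2)"
      by simp
    also have "\<dots> \<le> v0\<^sup>2 + (4 * D * (1 + K) / c\<^sup>2) * 2"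
    proof (intro add_mono mult_left_mono sum_inverse_squares_le)
      show "h 0 N \<le> v0\<^sup>2"
        using Bochner_Integration.integral_mono[OF shift_int V_int shift_le, of 0 N] by (simp add: h_def V_0 prob_space)
      show "0 \<le> 4 * D * (1 + K) / c\<^sup>2" using D by (simp add: K_def)
    qed
    also have "(4 * D * (1 + K) / c\<^sup>2) * 2 = (16 * D) * ((1 + K) / (2 * c\<^sup>2))" by simp
    also have "\<dots> \<le> c\<^sup>2 * ((1 + K) / (2 * c\<^sup>2))"
      using c by (intro mult_right_mono) (auto simp: K_def)
    also have "\<dots> = (1 + K) / 2" using c(1) by simp
    finally have "h N 0 \<le> v0\<^sup>2 + (1 + K) / 2" by simp
    then show ?case using V_nonneg by (simp add: h_def K_def max_absorb2 field_simps)
  qed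
qed

end

section \<open>The sampled closed loop\<close>

text \<open>Entry \<open>t mod k\<close> of the history is the state at the start of the current
  block, and it is always among the \<open>k\<close> visible entries.\<close>

definition sampled_policy :: "nat \<Rightarrow> (nat \<Rightarrow> 'a \<Rightarrow> 'b) \<Rightarrow> nat \<Rightarrow> (nat \<Rightarrow> 'a) \<Rightarrow> 'b" where
  "sampled_policy k \<phi> t h = \<phi> (t mod k) (h (t mod k))"

lemma cl_hist_eq_cl_state:
  "i \<le> t \<Longrightarrow> cl_hist A B k pol w x t i = cl_state A B k pol w x (t - i)"
proof (induction t arbitrary: i)
  case IH: (Suc t)
  show ?case
  proof (cases i)
    case 0
    then show ?thesis by (simp add: cl_state_def)
  next
    case (Suc j)
    then show ?thesis using IH.IH[of j] IH.prems by simp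
  qed
qed (simp add: cl_state_def)

lemma cl_state_0 [simp]: "cl_state A B k pol w x 0 = x"
  by (simp add: cl_state_def)

lemma cl_state_Suc:
  assumes "k > 0"
  shows "cl_state A B k (sampled_policy k \<phi>) w x (Suc t) = A *v cl_state A B k (sampled_policy k \<phi>) w x t
    + B *v \<phi> (t mod k) (cl_state A B k (sampled_policy k \<phi>) w x (t - t mod k)) + w t"
  using assms cl_hist_eq_cl_state[of "t mod k" t A B k "sampled_policy k \<phi>" w x]
  by (simp add: cl_state_def sampled_policy_def)

text \<open>Variation of constants within one block, where all controls are functions of its initial
  state.\<close>

lemma cl_state_block:
  fixes A :: "real^'d^'d" and B :: "real^'m^'d"
  assumes "k > 0" "j \<le> k"
  shows "cl_state A B k (sampled_policy k \<phi>) w x (k * n + j)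
    = ((*v) A ^^ j) (cl_state A B k (sampled_policy k \<phi>) w x (k * n))
      + (\<Sum>i<j. ((*v) A ^^ (j - Suc i)) (B *v \<phi> i (cl_state A B k (sampled_policy k \<phi>) w x (k * n))))
      + (\<Sum>i<j. ((*v) A ^^ (j - Suc i)) (w (k * n + i)))"
  using assms(2)
proof (induction j)
  case (Suc j)
  have "A *v (\<Sum>i<j. ((*v) A ^^ (j - Suc i)) (g i)) + g j = (\<Sum>i<Suc j. ((*v) A ^^ (Suc j - Suc i)) (g i))"
    for g :: "nat \<Rightarrow> real^'d"
  proof -
    have "A *v ((*v) A ^^ (j - Suc i)) (g i) = ((*v) A ^^ (j - i)) (g i)" if "i < j" for i
      using that by (simp flip: funpow.simps(2)[THEN fun_cong, unfolded o_apply] add: Suc_diff_Suc)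
    then show ?thesis by (simp add: matrix_vector_sum)
  qed
  note shift = this[symmetric]
  have "(k * n + j) mod k = j" using Suc.prems by simp
  then show ?case
    using Suc cl_state_Suc[OF assms(1), of A B \<phi> w x "k * n + j"]
    unfolding shift by (simp add: matrix_vector_right_distrib)
qed simp

text \<open>Causality; it allows the noise to be restricted to past indices when independence is
  proved.\<close>

lemma cl_state_cong:
  assumes "k > 0" "\<And>s. s < t \<Longrightarrow> w s = w' s"
  shows "cl_state A B k (sampled_policy k \<phi>) w x t = cl_state A B k (sampled_policy k \<phi>) w' x t"
  using assms(2)
proof (induction t rule: less_induct)
  case (less t)
  show ?case
  proof (cases t)
    case (Suc s)
    have "cl_state A B k (sampled_policy k \<phi>) w x j = cl_state A B k (sampled_policy k \<phi>) w' x j"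
      if "j \<le> s" for j
      using less that Suc by auto
    then show ?thesis
      using less.prems[of s] Suc by (simp add: cl_state_Suc[OF assms(1)])
  qed simp
qed

lemma borel_measurable_matrix_vector [measurable]:
  "(*v) A \<in> borel_measurable (borel :: (real^'n) measure)" for A :: "real^'n^'m"
  by (intro borel_measurable_continuous_onI linear_continuous_on) simp

lemma cl_state_measurable:
  fixes A :: "real^'d^'d" and B :: "real^'m^'d" and W :: "nat \<Rightarrow> 'w \<Rightarrow> real^'d"
  assumes "k > 0" and [measurable]: "\<And>i. \<phi> i \<in> borel_measurable borel"
    and "\<And>s. s < t \<Longrightarrow> W s \<in> borel_measurable N"
  shows "(\<lambda>\<omega>. cl_state A B k (sampled_policy k \<phi>) (\<lambda>s. W s \<omega>) x t) \<in> borel_measurable N"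
  using assms(3)
proof (induction t rule: less_induct)
  case (less t)
  show ?case
  proof (cases t)
    case (Suc s)
    have [measurable]: "(\<lambda>\<omega>. cl_state A B k (sampled_policy k \<phi>) (\<lambda>s. W s \<omega>) x j) \<in> borel_measurable N"
      if "j \<le> s" for j
      using less that Suc by auto
    have [measurable]: "W s \<in> borel_measurable N" using less.prems Suc by simp
    show ?thesis
      unfolding Suc cl_state_Suc[OF assms(1)] by measurable
  qed simp
qed

section \<open>Moment estimates for block sums and contractive recursions\<close>

lemma sum_power4_le:
  fixes a :: "'i \<Rightarrow> real"
  shows "(\<Sum>i\<in>I. a i) ^ 4 \<le> real (card I) ^ 3 * (\<Sum>i\<in>I. a i ^ 4)"
proof -
  have "(\<Sum>i\<in>I. a i) ^ 4 = ((\<Sum>i\<in>I. a i)\<^sup>2)\<^sup>2" by (simp flip: power_mult)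
  also have "\<dots> \<le> ((\<Sum>i\<in>I. (a i)\<^sup>2) * card I)\<^sup>2"
    by (intro power_mono sum_squared_le_sum_of_squares) auto
  also have "\<dots> = (\<Sum>i\<in>I. (a i)\<^sup>2)\<^sup>2 * real (card I) ^ 2"
    by (simp add: power_mult_distrib)
  also have "\<dots> \<le> ((\<Sum>i\<in>I. ((a i)\<^sup>2)\<^sup>2) * card I) * real (card I) ^ 2"
    by (intro mult_right_mono sum_squared_le_sum_of_squares) auto
  also have "\<dots> = real (card I) ^ 3 * (\<Sum>i\<in>I. a i ^ 4)"
    by (simp add: power2_eq_square power3_eq_cube power4_eq_xxxx mult.assoc)
  finally show ?thesis .
qed

context prob_space
begin

text \<open>Convexity of the square, applied to the weights \<theta> and 1 - \<theta> at the points
  u and v / (1 - \<theta>), gives a linear recursion for second moments whose fixed point is C / (1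
  - \<theta>)^2.\<close>

lemma contraction_second_moment:
  fixes Z b :: "nat \<Rightarrow> 'a \<Rightarrow> real"
  assumes Z_meas: "\<And>t. Z t \<in> borel_measurable M"
    and Z_nonneg: "\<And>t \<omega>. 0 \<le> Z t \<omega>" and b_nonneg: "\<And>t \<omega>. 0 \<le> b t \<omega>"
    and Z_0: "\<And>\<omega>. Z 0 \<omega> = z0"
    and Z_Suc: "\<And>t \<omega>. Z (Suc t) \<omega> \<le> \<theta> * Z t \<omega> + b t \<omega>"
    and b_int: "\<And>t. integrable M (\<lambda>\<omega>. (b t \<omega>)\<^sup>2)" and b_bound: "\<And>t. expectation (\<lambda>\<omega>. (b t \<omega>)\<^sup>2) \<le> C"
    and \<theta>: "0 < \<theta>" "\<theta> < 1"
  shows "integrable M (\<lambda>\<omega>. (Z t \<omega>)\<^sup>2) \<and> expectation (\<lambda>\<omega>. (Z t \<omega>)\<^sup>2) \<le> z0\<^sup>2 + C / (1 - \<theta>)\<^sup>2"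
proof -
  have "0 \<le> expectation (\<lambda>\<omega>. (b 0 \<omega>)\<^sup>2)" by simp
  then have C: "0 \<le> C" using b_bound[of 0] by linarith
  have convex: "(\<theta> * u + v)\<^sup>2 \<le> \<theta> * u\<^sup>2 + v\<^sup>2 / (1 - \<theta>)" for u v
  proof -
    have "(\<theta> * u + v)\<^sup>2 * (1 - \<theta>) + \<theta> * ((1 - \<theta>) * u - v)\<^sup>2 = (\<theta> * u\<^sup>2) * (1 - \<theta>) + v\<^sup>2"
      by (simp add: power2_eq_square algebra_simps)
    moreover have "0 \<le> \<theta> * ((1 - \<theta>) * u - v)\<^sup>2" using \<theta> by simp
    ultimately have "(\<theta> * u + v)\<^sup>2 * (1 - \<theta>) \<le> (\<theta> * u\<^sup>2) * (1 - \<theta>) + v\<^sup>2" by linarith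
    then have "(\<theta> * u + v)\<^sup>2 \<le> ((\<theta> * u\<^sup>2) * (1 - \<theta>) + v\<^sup>2) / (1 - \<theta>)"
      using \<theta> by (simp add: pos_le_divide_eq)
    then show ?thesis using \<theta> by (simp add: add_divide_distrib)
  qed
  show ?thesis
  proof (induction t)
    case 0
    show ?case using C by (simp add: Z_0 prob_space)
  next
    case (Suc t)
    have le: "(Z (Suc t) \<omega>)\<^sup>2 \<le> \<theta> * (Z t \<omega>)\<^sup>2 + (b t \<omega>)\<^sup>2 / (1 - \<theta>)" for \<omega>
      by (rule order_trans[OF power_mono[OF Z_Suc Z_nonneg] convex])
    have int: "integrable M (\<lambda>\<omega>. \<theta> * (Z t \<omega>)\<^sup>2 + (b t \<omega>)\<^sup>2 / (1 - \<theta>))"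
      using Suc b_int by simp
    have int': "integrable M (\<lambda>\<omega>. (Z (Suc t) \<omega>)\<^sup>2)"
      by (rule integrable_of_nonneg_le[OF int]) (use le Z_meas in simp_all)
    have "expectation (\<lambda>\<omega>. (Z (Suc t) \<omega>)\<^sup>2)
        \<le> expectation (\<lambda>\<omega>. \<theta> * (Z t \<omega>)\<^sup>2 + (b t \<omega>)\<^sup>2 / (1 - \<theta>))"
      by (intro Bochner_Integration.integral_mono int int' le)
    also have "\<dots> = \<theta> * expectation (\<lambda>\<omega>. (Z t \<omega>)\<^sup>2) + expectation (\<lambda>\<omega>. (b t \<omega>)\<^sup>2) / (1 - \<theta>)"
      using Suc b_int by simp
    also have "\<dots> \<le> \<theta> * (z0\<^sup>2 + C / (1 - \<theta>)\<^sup>2) + C / (1 - \<theta>)"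
      using Suc b_bound \<theta> by (intro add_mono mult_left_mono divide_right_mono) auto
    also have "\<dots> = \<theta> * z0\<^sup>2 + C / (1 - \<theta>)\<^sup>2"
    proof -
      have "C / (1 - \<theta>) = (1 - \<theta>) * (C / (1 - \<theta>)\<^sup>2)" using \<theta> by (simp add: power2_eq_square)
      then show ?thesis by (simp add: distrib_left left_diff_distrib diff_divide_distrib)
    qed
    also have "\<dots> \<le> z0\<^sup>2 + C / (1 - \<theta>)\<^sup>2"
      using \<theta> mult_right_mono[of \<theta> 1 "z0\<^sup>2"] by simp
    finally show ?case using int' by blast
  qed
qed

end

lemma fourth_moment_bound:
  fixes w :: "nat \<Rightarrow> 'w \<Rightarrow> 'v::real_normed_vector"
  assumes [measurable]: "\<And>t. (\<lambda>\<omega>. norm (w t \<omega>)) \<in> borel_measurable M"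
    and sup: "(SUP t. \<integral>\<^sup>+ \<omega>. ennreal (norm (w t \<omega>) ^ 4) \<partial>M) < \<infinity>"
  obtains C where "C \<ge> 0" "\<And>t. integrable M (\<lambda>\<omega>. norm (w t \<omega>) ^ 4)" "\<And>t. (\<integral>\<omega>. norm (w t \<omega>) ^ 4 \<partial>M) \<le> C"
proof -
  obtain C where C: "0 \<le> C" "(SUP t. \<integral>\<^sup>+ \<omega>. ennreal (norm (w t \<omega>) ^ 4) \<partial>M) = ennreal C"
    using sup by (cases "SUP t. \<integral>\<^sup>+ \<omega>. ennreal (norm (w t \<omega>) ^ 4) \<partial>M") auto
  have le: "(\<integral>\<^sup>+ \<omega>. ennreal (norm (w t \<omega>) ^ 4) \<partial>M) \<le> ennreal C" for t
    unfolding C(2)[symmetric] by (rule SUP_upper) simp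
  have int: "integrable M (\<lambda>\<omega>. norm (w t \<omega>) ^ 4)" for t
  proof (rule integrableI_bounded)
    show "(\<integral>\<^sup>+ \<omega>. ennreal (norm (norm (w t \<omega>) ^ 4)) \<partial>M) < \<infinity>"
      using le[of t] by (simp add: ennreal_less_top order_le_less_trans)
  qed simp
  have "(\<integral>\<omega>. norm (w t \<omega>) ^ 4 \<partial>M) \<le> C" for t
    using le[of t] nn_integral_eq_integral[OF int[of t]] C(1) by simp
  then show ?thesis using that C(1) int by blast
qed

text \<open>Of the two bounds on the controls, the one by \<open>C * r\<close> makes the policy
  bounded, and the one by \<open>limit_norm\<close> makes it small near the origin and zero at null
  states, where \<open>A\<close> alone is attracting.\<close>

locale sampled_loop = power_bounded_map "(*v) A" L for A :: "real^'d^'d" and L :: real +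
  fixes B :: "real^'m^'d" and \<phi> :: "nat \<Rightarrow> real^'d \<Rightarrow> real^'m" and C r \<beta> :: real
  assumes r: "r > 0" and C: "C \<ge> 0" and \<beta>: "\<beta> \<ge> 0"
    and B_bound: "norm (B *v v) \<le> \<beta> * norm v"
    and \<phi>_continuous: "continuous_on UNIV (\<phi> i)"
    and \<phi>_le_r: "i < CARD('d) \<Longrightarrow> norm (\<phi> i y) \<le> C * r"
    and \<phi>_le_limit_norm: "i < CARD('d) \<Longrightarrow> norm (\<phi> i y) \<le> C * limit_norm y"
    and block: "limit_norm (((*v) A ^^ CARD('d)) y
      + (\<Sum>i<CARD('d). ((*v) A ^^ (CARD('d) - Suc i)) (B *v \<phi> i y))) \<le> max (limit_norm y - r) 0"
begin

abbreviation state :: "(nat \<Rightarrow> real^'d) \<Rightarrow> real^'d \<Rightarrow> nat \<Rightarrow> real^'d" where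
  "state \<equiv> cl_state A B CARD('d) (sampled_policy CARD('d) \<phi>)"

lemma card_pos: "0 < CARD('d)"
  by simp

lemma norm_B\<phi>_le_r: "i < CARD('d) \<Longrightarrow> norm (B *v \<phi> i y) \<le> \<beta> * (C * r)"
  using B_bound[of "\<phi> i y"] mult_left_mono[OF \<phi>_le_r \<beta>, of i y] by linarith

lemma norm_B\<phi>_le_limit_norm: "i < CARD('d) \<Longrightarrow> norm (B *v \<phi> i y) \<le> \<beta> * (C * limit_norm y)"
  using B_bound[of "\<phi> i y"] mult_left_mono[OF \<phi>_le_limit_norm \<beta>, of i y] by linarith

text \<open>One block kills a seminorm of size at most \<open>r\<close>. From then on every sampled
  state is null, so all controls vanish and only \<open>A\<close> acts.\<close>

lemma noiseless_after_block:
  assumes x: "limit_norm x \<le> r"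
  shows "limit_norm (state (\<lambda>_. 0) x CARD('d)) = 0"
    and "state (\<lambda>_. 0) x (CARD('d) + n) = ((*v) A ^^ n) (state (\<lambda>_. 0) x CARD('d))"
proof -
  have "limit_norm (state (\<lambda>_. 0) x CARD('d)) \<le> max (limit_norm x - r) 0"
    using block[of x] cl_state_block[OF card_pos order_refl, of A B \<phi> "\<lambda>_. 0" x 0] by (simp add: iter_0)
  then show null: "limit_norm (state (\<lambda>_. 0) x CARD('d)) = 0"
    using x limit_norm_nonneg[of "state (\<lambda>_. 0) x CARD('d)"] by simp
  show "state (\<lambda>_. 0) x (CARD('d) + n) = ((*v) A ^^ n) (state (\<lambda>_. 0) x CARD('d))"
  proof (induction n rule: less_induct)
    case (less n)
    show ?case
    proof (cases n)
      case (Suc m)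
      \<comment> \<open>The start of the block containing the preceding time; the induction
        hypothesis at \<open>s\<close> makes the sampled state an iterate of a null state.\<close>
      define s where "s = CARD('d) + m - (CARD('d) + m) mod CARD('d)"
      have "s = CARD('d) + (m - m mod CARD('d))"
        by (simp add: s_def)
      then have "state (\<lambda>_. 0) x s = ((*v) A ^^ (m - m mod CARD('d))) (state (\<lambda>_. 0) x CARD('d))"
        using less[of "m - m mod CARD('d)"] Suc by simp
      then have "limit_norm (state (\<lambda>_. 0) x s) = 0" using null by simp
      then have "norm (B *v \<phi> (m mod CARD('d)) (state (\<lambda>_. 0) x s)) \<le> 0"
        using norm_B\<phi>_le_limit_norm[of "m mod CARD('d)" "state (\<lambda>_. 0) x s"] by simp
      then show ?thesis
        using cl_state_Suc[OF card_pos, of A B \<phi> "\<lambda>_. 0" x "CARD('d) + m"] less[of m] Suc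
        by (simp add: s_def)
    qed simp
  qed
qed

lemma asymp_stable: "asymp_stable_origin (\<lambda>x. state (\<lambda>_. 0) x)"
proof -
  \<comment> \<open>Within this radius the seminorm is at most \<open>r\<close>, so the first block
    is decisive.\<close>
  define \<eta> where "\<eta> = r / L"
  \<comment> \<open>The inner factor bounds the states of the first block, the outer
    \<open>L\<close> the free orbit after it.\<close>
  define D where "D = L * (L + CARD('d) * (L * (\<beta> * (C * L))))"
  have L: "1 \<le> L" by (rule M_ge_1)
  have \<eta>: "\<eta> > 0" using r L by (simp add: \<eta>_def)
  have small: "limit_norm x \<le> r" if "norm x < \<eta>" for x
    using limit_norm_le[of x] that L by (simp add: \<eta>_def field_simps)
  have first: "norm (state (\<lambda>_. 0) x t) \<le> (L + CARD('d) * (L * (\<beta> * (C * L)))) * norm x"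
    if "t \<le> CARD('d)" for x t
  proof -
    have "norm (state (\<lambda>_. 0) x t)
        = norm (((*v) A ^^ t) x + (\<Sum>i<t. ((*v) A ^^ (t - Suc i)) (B *v \<phi> i x)))"
      using cl_state_block[OF card_pos that, of A B \<phi> "\<lambda>_. 0" x 0] by (simp add: iter_0)
    also have "\<dots> \<le> L * norm x + (\<Sum>i<t. L * (\<beta> * (C * (L * norm x))))"
    proof (intro norm_triangle_mono bounded norm_sum[THEN order_trans] sum_mono)
      fix i assume "i \<in> {..<t}"
      then have "norm (B *v \<phi> i x) \<le> \<beta> * (C * limit_norm x)"
        using that by (intro norm_B\<phi>_le_limit_norm) auto
      also have "\<dots> \<le> \<beta> * (C * (L * norm x))"
        by (intro mult_left_mono limit_norm_le \<beta> C)
      finally have "L * norm (B *v \<phi> i x) \<le> L * (\<beta> * (C * (L * norm x)))"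
        using L by (intro mult_left_mono) auto
      then show "norm (((*v) A ^^ (t - Suc i)) (B *v \<phi> i x)) \<le> L * (\<beta> * (C * (L * norm x)))"
        using bounded[of "t - Suc i" "B *v \<phi> i x"] by linarith
    qed
    also have "\<dots> \<le> L * norm x + CARD('d) * (L * (\<beta> * (C * (L * norm x))))"
      using that L \<beta> C by (simp add: mult_right_mono)
    finally show ?thesis by (simp add: algebra_simps)
  qed
  have all: "norm (state (\<lambda>_. 0) x t) \<le> D * norm x" if "norm x < \<eta>" for x t
  proof (cases "t \<le> CARD('d)")
    case True
    have "1 * ((L + CARD('d) * (L * (\<beta> * (C * L)))) * norm x) \<le> D * norm x"
      unfolding D_def mult.assoc[of L] using L \<beta> C by (intro mult_right_mono) auto
    then show ?thesis using first[OF True, of x] by simp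
  next
    case False
    then obtain n where t: "t = CARD('d) + n" by (metis le_add_diff_inverse nat_le_linear)
    have "norm (state (\<lambda>_. 0) x t) \<le> L * norm (state (\<lambda>_. 0) x CARD('d))"
      unfolding t noiseless_after_block(2)[OF small[OF that]] by (rule bounded)
    also have "\<dots> \<le> L * ((L + CARD('d) * (L * (\<beta> * (C * L)))) * norm x)"
      using L by (intro mult_left_mono first) auto
    finally show ?thesis by (simp add: D_def mult.assoc)
  qed
  show ?thesis
    unfolding asymp_stable_origin_def
  proof (intro conjI allI impI)
    fix e :: real assume "e > 0"
    define \<delta> where "\<delta> = min \<eta> (e / (D + 1))"
    have "D \<ge> 0" unfolding D_def using L \<beta> C by simp
    have "\<delta> > 0" using \<eta> \<open>e > 0\<close> \<open>D \<ge> 0\<close> by (simp add: \<delta>_def)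
    moreover have "norm (state (\<lambda>_. 0) x t) < e" if "norm x < \<delta>" for x t
    proof -
      have "norm (state (\<lambda>_. 0) x t) \<le> D * norm x" using that by (intro all) (simp add: \<delta>_def)
      also have "\<dots> \<le> (D + 1) * norm x" by (simp add: mult_right_mono)
      also have "\<dots> < e" using that \<open>D \<ge> 0\<close> by (simp add: \<delta>_def field_simps)
      finally show ?thesis .
    qed
    ultimately show "\<exists>\<delta>>0. \<forall>x. norm x < \<delta> \<longrightarrow> (\<forall>t. norm (state (\<lambda>_. 0) x t) < e)" by blast
  next
    have "state (\<lambda>_. 0) x \<longlonglongrightarrow> 0" if "norm x < \<eta>" for x
    proof (rule LIMSEQ_offset)
      have "(\<lambda>n. ((*v) A ^^ n) (state (\<lambda>_. 0) x CARD('d))) \<longlonglongrightarrow> 0"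
        using noiseless_after_block(1)[OF small[OF that]] by (simp add: limit_norm_eq_0_iff)
      then show "(\<lambda>n. state (\<lambda>_. 0) x (n + CARD('d))) \<longlonglongrightarrow> 0"
        unfolding add.commute[of _ "CARD('d)"] noiseless_after_block(2)[OF small[OF that]] .
    qed
    then show "\<exists>\<eta>>0. \<forall>x. norm x < \<eta> \<longrightarrow> state (\<lambda>_. 0) x \<longlonglongrightarrow> 0" using \<eta> by blast
  qed
qed

end

section \<open>Second moments of the noisy closed loop\<close>

lemma power2_sum4_le: "(a + b + c + d)\<^sup>2 \<le> 4 * (a\<^sup>2 + b\<^sup>2 + c\<^sup>2 + d\<^sup>2)" for a b c d :: real
proof -
  have "4 * (a\<^sup>2 + b\<^sup>2 + c\<^sup>2 + d\<^sup>2) - (a + b + c + d)\<^sup>2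
      = (a - b)\<^sup>2 + (a - c)\<^sup>2 + (a - d)\<^sup>2 + (b - c)\<^sup>2 + (b - d)\<^sup>2 + (c - d)\<^sup>2"
    by (simp add: power2_eq_square algebra_simps)
  also have "\<dots> \<ge> 0" by simp
  finally show ?thesis by simp
qed

context sampled_loop
begin

text \<open>Two recursions are stacked: sampled once per block, the seminorm follows a Lindley
  recursion; at every single step the adapted norm \<open>q\<close> contracts, with the seminorm as
  part of its forcing.\<close>

lemma second_moment_bounded:
  fixes N :: "'w measure" and w :: "nat \<Rightarrow> 'w \<Rightarrow> real^'d" and W :: real
  assumes "prob_space N"
    and w_meas [measurable]: "\<And>t. w t \<in> borel_measurable N"
    and w_indep: "prob_space.indep_vars N (\<lambda>_. borel) w UNIV"
    and w_int4: "\<And>t. integrable N (\<lambda>\<omega>. norm (w t \<omega>) ^ 4)"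
    and w_le: "\<And>t. (\<integral>\<omega>. norm (w t \<omega>) ^ 4 \<partial>N) \<le> W"
    and \<rho>: "\<rho> = 1 + real CARD('d) ^ 3 * (real CARD('d) * (L ^ 4 * W))"
    and r_eq: "r = \<rho> + max 1 (16 * (\<rho> + \<rho>\<^sup>2))"
  shows "\<exists>K. \<forall>t. (\<integral>\<^sup>+ \<omega>. ennreal (norm (state (\<lambda>s. w s \<omega>) x t) ^ 2) \<partial>N) \<le> ennreal K"
proof -
  interpret prob_space N by fact
  let ?d = "CARD('d)"
  note [measurable] = borel_measurable_continuous_onI[OF \<phi>_continuous]
    borel_measurable_continuous_onI[OF continuous_on_limit_norm]
  have L: "1 \<le> L" by (rule M_ge_1)
  define X where "X t \<omega> = state (\<lambda>s. w s \<omega>) x t" for t \<omega>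
  \<comment> \<open>The excess over \<open>r\<close> is what satisfies the Lindley recursion: the
    next seminorm is at most \<open>V + \<xi>\<close>, and subtracting \<open>r\<close> gives the
    next excess.\<close>
  define V where "V n \<omega> = max 0 (limit_norm (X (?d * n) \<omega>) - r)" for n \<omega>
  define \<xi> where "\<xi> n \<omega> = (\<Sum>i<?d. limit_norm (w (?d * n + i) \<omega>))" for n \<omega>
  \<comment> \<open>The surplus \<open>r - \<rho>\<close> of the drift over the mean. The maximum
    with 1 gives c <= c^2, which converts a bound by \<open>c\<close> into the required one by
    \<open>c\<^sup>2\<close>.\<close>
  define c where "c = max 1 (16 * (\<rho> + \<rho>\<^sup>2))"
  have [measurable]: "X t \<in> borel_measurable N" for t
    unfolding X_def by (rule cl_state_measurable) auto
  have [measurable]: "V n \<in> borel_measurable N" "\<xi> n \<in> borel_measurable N" for n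
    unfolding V_def \<xi>_def by measurable
  have \<xi>_nonneg: "0 \<le> \<xi> n \<omega>" for n \<omega>
    unfolding \<xi>_def by (intro sum_nonneg limit_norm_nonneg)
  have V_nonneg: "0 \<le> V n \<omega>" for n \<omega>
    by (simp add: V_def)
  have within: "limit_norm (X (?d * n + j) \<omega>)
      \<le> limit_norm (((*v) A ^^ j) (X (?d * n) \<omega>)
          + (\<Sum>i<j. ((*v) A ^^ (j - Suc i)) (B *v \<phi> i (X (?d * n) \<omega>)))) + \<xi> n \<omega>"
    if "j \<le> ?d" for n j \<omega>
  proof -
    have "limit_norm (\<Sum>i<j. ((*v) A ^^ (j - Suc i)) (w (?d * n + i) \<omega>))
        \<le> (\<Sum>i<j. limit_norm (w (?d * n + i) \<omega>))"
      using limit_norm_sum[of "\<lambda>i. ((*v) A ^^ (j - Suc i)) (w (?d * n + i) \<omega>)" "{..<j}"] by simp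
    also have "\<dots> \<le> \<xi> n \<omega>"
      unfolding \<xi>_def using that by (intro sum_mono2) (auto simp: limit_norm_nonneg)
    finally show ?thesis
      unfolding X_def cl_state_block[OF card_pos that]
      by (intro order_trans[OF limit_norm_triangle] add_mono order_refl)
  qed
  have V_Suc: "V (Suc n) \<omega> \<le> max 0 (V n \<omega> + \<xi> n \<omega> - (\<rho> + c))" for n \<omega>
  proof -
    have "limit_norm (X (?d * Suc n) \<omega>) \<le> V n \<omega> + \<xi> n \<omega>"
      using within[OF order_refl, of n \<omega>] block[of "X (?d * n) \<omega>"]
      by (simp add: V_def add.commute max.commute)
    then show ?thesis by (simp add: V_def[of "Suc n"] r_eq[folded c_def])
  qed
  have indep: "indep_var borel (V n) borel (\<xi> n)" for n
  proof -
    \<comment> \<open>\<open>V n\<close> depends on the noise before block \<open>n\<close> and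
      \<open>\<xi> n\<close> on the noise inside it, so both factor through disjoint index
      sets.\<close>
    define I J where "I = {..<?d * n}" and "J = {?d * n..<?d * n + ?d}"
    define Y1 where "Y1 h = max 0 (limit_norm (state (\<lambda>s. h s) x (?d * n)) - r)" for h
    define Y2 where "Y2 h = (\<Sum>i<?d. limit_norm (h (?d * n + i)))" for h
    have "indep_var (PiM I (\<lambda>_. borel)) (\<lambda>\<omega>. \<lambda>i\<in>I. w i \<omega>) (PiM J (\<lambda>_. borel)) (\<lambda>\<omega>. \<lambda>i\<in>J. w i \<omega>)"
      by (rule indep_var_restrict[OF w_indep]) (auto simp: I_def J_def)
    moreover have "Y1 \<in> borel_measurable (PiM I (\<lambda>_. borel))"
    proof -
      have [measurable]: "(\<lambda>h. state (\<lambda>s. h s) x (?d * n)) \<in> borel_measurable (PiM I (\<lambda>_. borel))"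
        by (rule cl_state_measurable) (auto simp: I_def)
      show ?thesis unfolding Y1_def by measurable
    qed
    moreover have "Y2 \<in> borel_measurable (PiM J (\<lambda>_. borel))"
    proof -
      have [measurable]: "(\<lambda>h. h (?d * n + i)) \<in> borel_measurable (PiM J (\<lambda>_. borel :: (real^'d) measure))"
        if "i \<in> {..<?d}" for i
        using that by (intro measurable_component_singleton) (auto simp: J_def)
      show ?thesis unfolding Y2_def by measurable
    qed
    ultimately have "indep_var borel (Y1 \<circ> (\<lambda>\<omega>. \<lambda>i\<in>I. w i \<omega>)) borel (Y2 \<circ> (\<lambda>\<omega>. \<lambda>i\<in>J. w i \<omega>))"
      by (rule indep_var_compose)
    moreover have "Y1 \<circ> (\<lambda>\<omega>. \<lambda>i\<in>I. w i \<omega>) = V n"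
    proof
      fix \<omega>
      have "state (\<lambda>s. (\<lambda>i\<in>I. w i \<omega>) s) x (?d * n) = state (\<lambda>s. w s \<omega>) x (?d * n)"
        by (rule cl_state_cong) (auto simp: I_def)
      then show "(Y1 \<circ> (\<lambda>\<omega>. \<lambda>i\<in>I. w i \<omega>)) \<omega> = V n \<omega>" by (simp add: Y1_def V_def X_def)
    qed
    moreover have "Y2 \<circ> (\<lambda>\<omega>. \<lambda>i\<in>J. w i \<omega>) = \<xi> n"
      by (auto simp: Y2_def \<xi>_def J_def fun_eq_iff intro!: sum.cong)
    ultimately show ?thesis by simp
  qed
  have \<xi>4: "\<xi> n \<omega> ^ 4 \<le> real ?d ^ 3 * (\<Sum>i<?d. L ^ 4 * norm (w (?d * n + i) \<omega>) ^ 4)" for n \<omega>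
  proof -
    have "\<xi> n \<omega> ^ 4 \<le> real ?d ^ 3 * (\<Sum>i<?d. limit_norm (w (?d * n + i) \<omega>) ^ 4)"
      unfolding \<xi>_def using sum_power4_le[of "\<lambda>i. limit_norm (w (?d * n + i) \<omega>)" "{..<?d}"] by simp
    also have "\<dots> \<le> real ?d ^ 3 * (\<Sum>i<?d. (L * norm (w (?d * n + i) \<omega>)) ^ 4)"
      by (intro mult_left_mono sum_mono power_mono limit_norm_le limit_norm_nonneg) auto
    finally show ?thesis by (simp add: power_mult_distrib)
  qed
  have \<xi>_int4: "integrable N (\<lambda>\<omega>. \<xi> n \<omega> ^ 4)" for n
    by (rule integrable_of_nonneg_le[OF _ _ _ \<xi>4]) (use w_int4 \<xi>_nonneg in auto)
  note \<xi>_int = integrable_power_of_power4[OF \<open>\<And>n. \<xi> n \<in> borel_measurable N\<close> \<xi>_int4 \<xi>_nonneg]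
  \<comment> \<open>\<rho> exceeds this bound by 1 because the first and second moments are
    estimated by one plus the fourth.\<close>
  have D4: "expectation (\<lambda>\<omega>. \<xi> n \<omega> ^ 4) \<le> \<rho> - 1" for n
  proof -
    have "expectation (\<lambda>\<omega>. \<xi> n \<omega> ^ 4)
        \<le> expectation (\<lambda>\<omega>. real ?d ^ 3 * (\<Sum>i<?d. L ^ 4 * norm (w (?d * n + i) \<omega>) ^ 4))"
      by (intro Bochner_Integration.integral_mono \<xi>_int4 \<xi>4) (use w_int4 in auto)
    also have "\<dots> = real ?d ^ 3 * (\<Sum>i<?d. L ^ 4 * expectation (\<lambda>\<omega>. norm (w (?d * n + i) \<omega>) ^ 4))"
      using w_int4 by simp
    also have "\<dots> \<le> real ?d ^ 3 * (\<Sum>i<?d. L ^ 4 * W)"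
      using L by (intro mult_left_mono sum_mono w_le) auto
    finally show ?thesis by (simp add: \<rho>)
  qed
  have moment_le: "expectation Y \<le> 1 + expectation (\<lambda>\<omega>. Z \<omega> ^ 4)"
    if "integrable N Y" "integrable N (\<lambda>\<omega>. Z \<omega> ^ 4)" "\<And>\<omega>. Y \<omega> \<le> 1 + Z \<omega> ^ 4" for Y Z :: "'w \<Rightarrow> real"
    using Bochner_Integration.integral_mono[OF that(1) _ that(3)] that(2) by (simp add: prob_space)
  have mean: "expectation (\<xi> n) \<le> \<rho>" for n
    using moment_le[OF \<xi>_int(1) \<xi>_int4 le_one_plus_power4(1)[OF \<xi>_nonneg], of n] D4[of n] by simp
  have D2': "expectation (\<lambda>\<omega>. (\<xi> n \<omega>)\<^sup>2) \<le> \<rho>" for n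
    using moment_le[OF \<xi>_int(2) \<xi>_int4 le_one_plus_power4(2)[OF \<xi>_nonneg], of n] D4[of n] by simp
  then have D2: "expectation (\<lambda>\<omega>. (\<xi> n \<omega>)\<^sup>2 + \<rho>\<^sup>2) \<le> \<rho> + \<rho>\<^sup>2" for n
    using \<xi>_int(2)[of n] by (simp add: prob_space)
  have "0 \<le> \<rho>\<^sup>2" by simp
  then have D4': "expectation (\<lambda>\<omega>. \<xi> n \<omega> ^ 4) \<le> \<rho> + \<rho>\<^sup>2" for n
    using D4[of n] by linarith
  have c: "0 < c" "16 * (\<rho> + \<rho>\<^sup>2) \<le> c\<^sup>2"
  proof -
    have "1 \<le> c" "16 * (\<rho> + \<rho>\<^sup>2) \<le> c" by (auto simp: c_def)
    moreover have "c * 1 \<le> c * c" using \<open>1 \<le> c\<close> by (intro mult_left_mono) auto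
    ultimately show "0 < c" "16 * (\<rho> + \<rho>\<^sup>2) \<le> c\<^sup>2"
      unfolding power2_eq_square[of c] by linarith+
  qed
  have V_0: "V 0 \<omega> = max 0 (limit_norm x - r)" for \<omega>
    by (simp add: V_def X_def)
  define v where "v = 2 * (max 0 (limit_norm x - r))\<^sup>2 + 1"
  have V_int: "integrable N (\<lambda>\<omega>. (V n \<omega>)\<^sup>2)" and V_le: "expectation (\<lambda>\<omega>. (V n \<omega>)\<^sup>2) \<le> v" for n
    using lindley_second_moment[of V \<xi>, OF _ _ V_nonneg \<xi>_nonneg V_0 V_Suc indep \<xi>_int4 mean D2 D4' c, of n]
    by (auto simp: v_def)
  obtain q \<theta> E where q: "0 < \<theta>" "\<theta> < 1" "E \<ge> 0" "\<And>x. norm x \<le> q x" "\<And>x. q x \<le> E * norm x"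
    "\<And>x y. q (x + y) \<le> q x + q y" "\<And>x. q (A *v x) \<le> \<theta> * q x + E * limit_norm x" "continuous_on UNIV q"
    by (rule adapted_norm_exists) blast
  note [measurable] = borel_measurable_continuous_onI[OF q(8)]
  \<comment> \<open>The bounded part of the forcing: the threshold \<open>r\<close>, the controls
    already applied in the block, and the control of the current step.\<close>
  define c0 where "c0 = r + real ?d * (L * (\<beta> * (C * r))) + \<beta> * (C * r)"
  have c0: "0 \<le> c0" using r C \<beta> L by (simp add: c0_def)
  define b where "b t \<omega> = E * (V (t div ?d) \<omega> + \<xi> (t div ?d) \<omega> + c0 + norm (w t \<omega>))" for t \<omega>
  have b_nonneg: "0 \<le> b t \<omega>" for t \<omega>
    unfolding b_def using V_nonneg \<xi>_nonneg c0 q(3) by (intro mult_nonneg_nonneg add_nonneg_nonneg) auto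
  \<comment> \<open>Inside a block the controls need not decrease the seminorm; they can only raise
    it by a bounded amount beyond its value at the start, apart from the noise.\<close>
  have limit_le: "limit_norm (X t \<omega>) \<le> V (t div ?d) \<omega> + r + real ?d * (L * (\<beta> * (C * r))) + \<xi> (t div ?d) \<omega>" for t \<omega>
  proof -
    define n j where "n = t div ?d" and "j = t mod ?d"
    have j: "j < ?d" by (simp add: j_def)
    have t: "t = ?d * n + j" by (simp add: n_def j_def)
    let ?y = "X (?d * n) \<omega>"
    have "limit_norm (((*v) A ^^ j) ?y + (\<Sum>i<j. ((*v) A ^^ (j - Suc i)) (B *v \<phi> i ?y)))
        \<le> limit_norm ?y + (\<Sum>i<j. limit_norm (((*v) A ^^ (j - Suc i)) (B *v \<phi> i ?y)))"
      by (rule order_trans[OF limit_norm_triangle add_mono[OF _ limit_norm_sum]]) simp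
    also have "\<dots> \<le> limit_norm ?y + (\<Sum>i<j. L * (\<beta> * (C * r)))"
    proof (intro add_left_mono sum_mono)
      fix i assume "i \<in> {..<j}"
      then have "L * norm (B *v \<phi> i ?y) \<le> L * (\<beta> * (C * r))"
        using j L by (intro mult_left_mono norm_B\<phi>_le_r) auto
      then show "limit_norm (((*v) A ^^ (j - Suc i)) (B *v \<phi> i ?y)) \<le> L * (\<beta> * (C * r))"
        using limit_norm_le[of "B *v \<phi> i ?y"] by simp
    qed
    also have "\<dots> \<le> limit_norm ?y + real ?d * (L * (\<beta> * (C * r)))"
      using j L \<beta> C r by (simp add: mult_right_mono)
    also have "limit_norm ?y \<le> V n \<omega> + r" by (simp add: V_def)
    finally show ?thesis
      using within[of j n \<omega>] j by (simp add: t[symmetric] n_def[symmetric])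
  qed
  have X_Suc: "q (X (Suc t) \<omega>) \<le> \<theta> * q (X t \<omega>) + b t \<omega>" for t \<omega>
  proof -
    let ?u = "B *v \<phi> (t mod ?d) (X (t - t mod ?d) \<omega>)"
    have "q (X (Suc t) \<omega>) = q (A *v X t \<omega> + ?u + w t \<omega>)"
      by (simp add: X_def cl_state_Suc)
    also have "\<dots> \<le> q (A *v X t \<omega>) + q ?u + q (w t \<omega>)"
      using q(6)[of "A *v X t \<omega> + ?u" "w t \<omega>"] q(6)[of "A *v X t \<omega>" ?u] by linarith
    also have "\<dots> \<le> (\<theta> * q (X t \<omega>) + E * limit_norm (X t \<omega>)) + E * norm ?u + E * norm (w t \<omega>)"
      by (intro add_mono q)
    also have "\<dots> \<le> (\<theta> * q (X t \<omega>)
        + E * (V (t div ?d) \<omega> + r + real ?d * (L * (\<beta> * (C * r))) + \<xi> (t div ?d) \<omega>))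
        + E * (\<beta> * (C * r)) + E * norm (w t \<omega>)"
      using q(3) by (intro add_mono mult_left_mono limit_le norm_B\<phi>_le_r order_refl) auto
    also have "\<dots> = \<theta> * q (X t \<omega>) + b t \<omega>"
      by (simp add: b_def c0_def distrib_left)
    finally show ?thesis .
  qed
  have w_int2: "integrable N (\<lambda>\<omega>. (norm (w t \<omega>))\<^sup>2)" for t
    by (rule integrable_power_of_power4[OF _ w_int4]) auto
  have w_le2: "expectation (\<lambda>\<omega>. (norm (w t \<omega>))\<^sup>2) \<le> 1 + W" for t
    using moment_le[OF w_int2 w_int4 le_one_plus_power4(2)[OF norm_ge_zero], of t] w_le[of t] by simp
  have b_sq: "(b t \<omega>)\<^sup>2
      \<le> E\<^sup>2 * (4 * ((V (t div ?d) \<omega>)\<^sup>2 + (\<xi> (t div ?d) \<omega>)\<^sup>2 + c0\<^sup>2 + (norm (w t \<omega>))\<^sup>2))" for t \<omega>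
    unfolding b_def power_mult_distrib by (intro mult_left_mono power2_sum4_le) auto
  have b_sq_int: "integrable N (\<lambda>\<omega>. E\<^sup>2 * (4 * ((V (t div ?d) \<omega>)\<^sup>2 + (\<xi> (t div ?d) \<omega>)\<^sup>2 + c0\<^sup>2 + (norm (w t \<omega>))\<^sup>2)))" for t
    using V_int \<xi>_int(2) w_int2 by simp
  have b_int: "integrable N (\<lambda>\<omega>. (b t \<omega>)\<^sup>2)" for t
    by (rule integrable_of_nonneg_le[OF b_sq_int _ _ b_sq]) (auto simp: b_def)
  have b_le: "expectation (\<lambda>\<omega>. (b t \<omega>)\<^sup>2) \<le> E\<^sup>2 * (4 * (v + \<rho> + c0\<^sup>2 + (1 + W)))" for t
  proof -
    have "expectation (\<lambda>\<omega>. (b t \<omega>)\<^sup>2)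
        \<le> E\<^sup>2 * (4 * (expectation (\<lambda>\<omega>. (V (t div ?d) \<omega>)\<^sup>2) + expectation (\<lambda>\<omega>. (\<xi> (t div ?d) \<omega>)\<^sup>2)
            + c0\<^sup>2 + expectation (\<lambda>\<omega>. (norm (w t \<omega>))\<^sup>2)))"
      using Bochner_Integration.integral_mono[OF b_int b_sq_int b_sq, of t] V_int \<xi>_int(2) w_int2
      by (simp add: prob_space)
    also have "\<dots> \<le> E\<^sup>2 * (4 * (v + \<rho> + c0\<^sup>2 + (1 + W)))"
      by (intro mult_left_mono add_mono V_le D2' w_le2 order_refl) auto
    finally show ?thesis .
  qed
  define K where "K = (q x)\<^sup>2 + E\<^sup>2 * (4 * (v + \<rho> + c0\<^sup>2 + (1 + W))) / (1 - \<theta>)\<^sup>2"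
  have q_nonneg: "0 \<le> q y" for y using q(4)[of y] norm_ge_zero[of y] by linarith
  have qX: "integrable N (\<lambda>\<omega>. (q (X t \<omega>))\<^sup>2) \<and> expectation (\<lambda>\<omega>. (q (X t \<omega>))\<^sup>2) \<le> K" for t
    unfolding K_def
    by (rule contraction_second_moment[where Z = "\<lambda>t \<omega>. q (X t \<omega>)" and b = b])
       (use q_nonneg b_nonneg X_Suc b_int b_le q(1,2) in \<open>auto simp: X_def[of 0]\<close>)
  have "(\<integral>\<^sup>+ \<omega>. ennreal (norm (state (\<lambda>s. w s \<omega>) x t) ^ 2) \<partial>N) \<le> ennreal K" for t
  proof -
    have "(\<integral>\<^sup>+ \<omega>. ennreal (norm (state (\<lambda>s. w s \<omega>) x t) ^ 2) \<partial>N)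
        \<le> (\<integral>\<^sup>+ \<omega>. ennreal ((q (X t \<omega>))\<^sup>2) \<partial>N)"
      unfolding X_def by (intro nn_integral_mono ennreal_leI power_mono q) auto
    also have "\<dots> = ennreal (expectation (\<lambda>\<omega>. (q (X t \<omega>))\<^sup>2))"
      using qX by (intro nn_integral_eq_integral) auto
    also have "\<dots> \<le> ennreal K" using qX by (intro ennreal_leI) auto
    finally show ?thesis .
  qed
  then show ?thesis by blast
qed

end

theorem theorem1:
  fixes A :: "real^'d^'d" and B :: "real^'m^'d"
    and M :: "'w measure" and w :: "nat \<Rightarrow> 'w \<Rightarrow> real^'d" and Q :: "nat \<Rightarrow> real^'d^'d"
  assumes eig_disk: "\<And>l. is_eigenvalue A l \<Longrightarrow> cmod l \<le> 1"
    and eig_unit: "\<And>l. is_eigenvalue A l \<Longrightarrow> cmod l = 1 \<Longrightarrow> alg_mult A l = geom_mult A l"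
    and stab: "stabilizable A B"
    and P: "prob_space M"
    and w_meas: "\<And>t. w t \<in> borel_measurable M"
    and w_indep: "prob_space.indep_vars M (\<lambda>_. borel) w UNIV"
    and w_int: "\<And>t. integrable M (w t)"
    and w_mean: "\<And>t. (\<integral>\<omega>. w t \<omega> \<partial>M) = 0"
    and w_cov_int: "\<And>t. integrable M (\<lambda>\<omega>. (\<chi> i j. w t \<omega> $ i * w t \<omega> $ j) :: real^'d^'d)"
    and w_cov: "\<And>t. (\<integral>\<omega>. ((\<chi> i j. w t \<omega> $ i * w t \<omega> $ j) :: real^'d^'d) \<partial>M) = Q t"
    and w_4th: "(SUP t. \<integral>\<^sup>+ \<omega>. ennreal (norm (w t \<omega>) ^ 4) \<partial>M) < \<infinity>"
  shows "\<exists>(R::real) (k::nat) (pol :: nat \<Rightarrow> (nat \<Rightarrow> real^'d) \<Rightarrow> real^'m).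
           R > 0 \<and> 1 \<le> k \<and> k \<le> CARD('d) \<and>
           (\<forall>t. pol t \<in> borel_measurable (PiM {..<k} (\<lambda>_. borel))) \<and>
           (\<forall>t. \<forall>h \<in> (\<Pi>\<^sub>E i\<in>{..<k}. UNIV). norm (pol t h) \<le> R) \<and>
           (\<forall>x. (SUP t. \<integral>\<^sup>+ \<omega>. ennreal (norm (cl_state A B k pol (\<lambda>s. w s \<omega>) x t) ^ 2) \<partial>M)
                  < \<infinity>) \<and>
           asymp_stable_origin (\<lambda>x. cl_state A B k pol (\<lambda>_. 0) x)"
proof -
  obtain L where L: "\<And>n x. norm (((*v) A ^^ n) x) \<le> L * norm x"
    using power_bounded_uniformly[of "(*v) A"] orbits_bounded[OF eig_disk eig_unit]
    by (metis matrix_vector_mul_linear)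
  obtain K where K: "\<And>l. is_eigenvalue (A + B ** K) l \<Longrightarrow> cmod l < 1"
    using stab unfolding stabilizable_def by blast
  interpret controlled_map "(*v) A" L "(*v) B" "(*v) K"
  proof
    have "(\<lambda>x. A *v x + B *v (K *v x)) = (*v) (A + B ** K)"
      by (simp add: fun_eq_iff matrix_vector_mult_add_rdistrib matrix_vector_mul_assoc)
    then show "(\<lambda>n. ((\<lambda>x. A *v x + B *v (K *v x)) ^^ n) x) \<longlonglongrightarrow> 0" for x
      using orbits_decay[OF K] by simp
  qed (use L in \<open>auto simp: matrix_vector_right_distrib matrix_vector_mult_scaleR\<close>)
  obtain \<phi> C where \<phi>: "C \<ge> 0" "\<And>r i. r > 0 \<Longrightarrow> continuous_on UNIV (\<phi> r i)"
    "\<And>r i y. r > 0 \<Longrightarrow> i < DIM(real^'d) \<Longrightarrow> norm (\<phi> r i y) \<le> C * r"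
    "\<And>r i y. r > 0 \<Longrightarrow> i < DIM(real^'d) \<Longrightarrow> norm (\<phi> r i y) \<le> C * limit_norm y"
    "\<And>r y. r > 0 \<Longrightarrow> limit_norm (((*v) A ^^ DIM(real^'d)) y
        + (\<Sum>i<DIM(real^'d). ((*v) A ^^ (DIM(real^'d) - Suc i)) (B *v \<phi> r i y))) \<le> max (limit_norm y - r) 0"
    by (rule saturated_controls_exist) blast
  have w_norm_meas: "(\<lambda>\<omega>. norm (w t \<omega>)) \<in> borel_measurable M" for t
    using w_meas by simp
  obtain W where W: "W \<ge> 0" "\<And>t. integrable M (\<lambda>\<omega>. norm (w t \<omega>) ^ 4)"
      "\<And>t. (\<integral>\<omega>. norm (w t \<omega>) ^ 4 \<partial>M) \<le> W"
    using fourth_moment_bound[OF w_norm_meas w_4th] by blast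
  \<comment> \<open>The fourth moment of a sum of \<open>d\<close> terms costs a factor
    \<open>d ^ 3\<close>, there are \<open>d\<close> noise vectors in a block, and
    \<open>L ^ 4 * W\<close> bounds the fourth moment of the seminorm of each.\<close>
  define \<rho> where "\<rho> = 1 + real CARD('d) ^ 3 * (real CARD('d) * (L ^ 4 * W))"
  define r where "r = \<rho> + max 1 (16 * (\<rho> + \<rho>\<^sup>2))"
  have "\<rho> \<ge> 1" using W(1) by (simp add: \<rho>_def)
  then have r: "r > 0" by (simp add: r_def)
  obtain \<beta> where \<beta>: "\<beta> > 0" "\<And>v. norm (B *v v) \<le> \<beta> * norm v"
    using linear_bounded_pos[of "(*v) B"] by auto
  interpret sampled_loop A L B "\<phi> r" C r \<beta>
    by unfold_locales (use \<phi> r \<beta> in auto)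
  let ?pol = "sampled_policy CARD('d) (\<phi> r)"
  have "(SUP t. \<integral>\<^sup>+ \<omega>. ennreal (norm (state (\<lambda>s. w s \<omega>) x t) ^ 2) \<partial>M) < \<infinity>" for x
  proof -
    obtain K where "\<And>t. (\<integral>\<^sup>+ \<omega>. ennreal (norm (state (\<lambda>s. w s \<omega>) x t) ^ 2) \<partial>M) \<le> ennreal K"
      using second_moment_bounded[OF P w_meas w_indep W(2,3) \<rho>_def r_def] by blast
    then have "(SUP t. \<integral>\<^sup>+ \<omega>. ennreal (norm (state (\<lambda>s. w s \<omega>) x t) ^ 2) \<partial>M) \<le> ennreal K"
      by (rule SUP_least)
    then show ?thesis by (simp add: order_le_less_trans)
  qed
  moreover have "?pol t \<in> borel_measurable (PiM {..<CARD('d)} (\<lambda>_. borel))" for t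
  proof -
    have [measurable]: "\<phi> r (t mod CARD('d)) \<in> borel_measurable borel"
      by (rule borel_measurable_continuous_onI[OF \<phi>(2)[OF r]])
    have [measurable]: "(\<lambda>h. h (t mod CARD('d))) \<in> borel_measurable (PiM {..<CARD('d)} (\<lambda>_. borel :: (real^'d) measure))"
      by (rule measurable_component_singleton) simp
    show ?thesis unfolding sampled_policy_def by measurable
  qed
  \<comment> \<open>\<open>C\<close> may be 0; the added 1 keeps the radius positive.\<close>
  moreover have "norm (?pol t h) \<le> C * r + 1" for t h
    unfolding sampled_policy_def using \<phi>_le_r[of "t mod CARD('d)" "h (t mod CARD('d))"] by simp
  moreover have "C * r + 1 > 0" using \<phi>(1) r by (simp add: add_nonneg_pos)
  moreover have "1 \<le> CARD('d)" using card_pos by linarith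
  ultimately show ?thesis
    using asymp_stable by (intro exI[of _ "C * r + 1"] exI[of _ "CARD('d)"] exI[of _ ?pol]) auto
qed

end
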